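(* Let $\mathcal{T}^d=(\mathcal{N},\mathcal{E},d)$ be an oriented tree diagram with $\mathcal{N}=\{\iota_1,\dots,\iota_n\}$, let $\mathcal{H}=\mathrm{Span}_{\mathbb{C}}\{x_i\partial_{x_i}\mid\iota_i\in\mathcal{N}\}$, and let $L_1(\mathcal{T}^d)=\mathcal{H}+L_0(\mathcal{T}^d)$. Then the cohomology $H(L_1(\mathcal{T}^d))=\bigoplus_{i\ge 0}H^i(L_1(\mathcal{T}^d))$ with trivial coefficients is isomorphic, as a graded vector space, to the exterior algebra $\wedge\mathcal{H}=\bigoplus_{i\ge 0}\wedge^i\mathcal{H}$.
   Context: Everything is over $\mathbb{C}$. An oriented tree is a pair $(\mathcal{N},\mathcal{E})$ with $\mathcal{N}=\{\iota_1,\dots,\iota_n\}$ (nodes) and $\mathcal{E}\subset\{(\iota_i,\iota_j)\mid 1\le i<j\le n\}$ (oriented edges) such that the underlying undirected graph is connected and has no cycles. An oriented tree diagram $\mathcal{T}^d=(\mathcal{N},\mathcal{E},d)$ is an oriented tree together with a weight map $d:\mathcal{E}\to\mathbb{Z}_+$ (positive integers). A node $\iota$ is a root node if there is no edge $(\iota',\iota)\in\mathcal{E}$; $\Lambda$ denotes the set of root nodes. $L_0(\mathcal{T}^d)$ is the Lie subalgebra, under the commutator bracket $[A,B]=AB-BA$, of the algebra of differential operators in $x_1,\dots,x_n$ with coefficients in $\mathbb{C}[x_1,\dots,x_n]$, generated by $\{\partial_{x_i},\ x_j^{d[(\iota_j,\iota_k)]}\partial_{x_k}\mid\iota_i\in\Lambda,\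 (\iota_j,\iota_k)\in\mathcal{E}\}$. $L_1(\mathcal{T}^d)=\sum_{i=1}^n\mathbb{C}x_i\partial_{x_i}+L_0(\mathcal{T}^d)$ is a finite-dimensional solvable Lie algebra under the same bracket. Cohomology is Chevalley–Eilenberg cohomology with coefficients in the trivial module $\mathbb{C}$. *)

theory Defs
  imports
    Complex_Main
    "HOL-Library.Poly_Mapping"
    "HOL-Library.Function_Algebras"
    "HOL-Library.Set_Algebras"
begin

text \<open>
  Additive structure on functions and on sets is pointwise, respectively elementwise
  (Minkowski), as provided by \<^theory>\<open>HOL-Library.Function_Algebras\<close> and
  \<^theory>\<open>HOL-Library.Set_Algebras\<close>.
\<close>

subsection \<open>Oriented tree diagrams\<close>

text \<open>
  The nodes $\iota_1, \dots, \iota_n$ are the elements of a finite linearly ordered type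
  \<open>'n\<close>, in increasing order, so that $n$ is the cardinality of \<open>'n\<close>.
  Because edges go from smaller to larger nodes, the underlying undirected graph has neither
  loops nor multiple edges, and its cycles are the cyclic sequences of at least three
  distinct nodes.
\<close>

definition undirected_connected :: "('n \<times> 'n) set \<Rightarrow> bool" where
  "undirected_connected E \<longleftrightarrow> (\<forall>u v. (u, v) \<in> (E \<union> E\<inverse>)\<^sup>*)"

definition undirected_cycle :: "('n \<times> 'n) set \<Rightarrow> 'n list \<Rightarrow> bool" where
  "undirected_cycle E p \<longleftrightarrow> 3 \<le> length p \<and> distinct p \<and>
     (\<forall>l < length p. (p ! l, p ! (Suc l mod length p)) \<in> E \<union> E\<inverse>)"

definition oriented_tree :: "('n::{finite,linorder} \<times> 'n) set \<Rightarrow> bool" where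
  "oriented_tree E \<longleftrightarrow>
     (\<forall>(i, j) \<in> E. i < j) \<and> undirected_connected E \<and> (\<nexists>p. undirected_cycle E p)"

definition oriented_tree_diagram ::
    "('n::{finite,linorder} \<times> 'n) set \<Rightarrow> ('n \<times> 'n \<Rightarrow> nat) \<Rightarrow> bool" where
  "oriented_tree_diagram E d \<longleftrightarrow> oriented_tree E \<and> (\<forall>e \<in> E. 0 < d e)"

definition root_nodes :: "('n \<times> 'n) set \<Rightarrow> 'n set" where
  "root_nodes E = {i. \<nexists>j. (j, i) \<in> E}"


subsection \<open>Finitely supported functions and operators as complex vector spaces\<close>

definition pm_scale :: "complex \<Rightarrow> ('a \<Rightarrow>\<^sub>0 complex) \<Rightarrow> ('a \<Rightarrow>\<^sub>0 complex)" where
  "pm_scale c p = Poly_Mapping.map ((*) c) p"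

lemma lookup_pm_scale [simp]:
  "Poly_Mapping.lookup (pm_scale c p) a = c * Poly_Mapping.lookup p a"
  by (simp add: pm_scale_def Poly_Mapping.map.rep_eq when_def)

global_interpretation pm: vector_space pm_scale
  by unfold_locales (auto intro!: poly_mapping_eqI simp: lookup_add algebra_simps)

text \<open>
  \<open>'n mpoly\<close> is the polynomial ring over the complex numbers in the variables
  $x_i$, $i$ in \<open>'n\<close>: a polynomial maps exponent vectors to coefficients.
\<close>

type_synonym 'n mpoly = "('n \<Rightarrow>\<^sub>0 nat) \<Rightarrow>\<^sub>0 complex"

definition op_scale :: "complex \<Rightarrow> ('n mpoly \<Rightarrow> 'n mpoly) \<Rightarrow> ('n mpoly \<Rightarrow> 'n mpoly)" where
  "op_scale c A = (\<lambda>p. pm_scale c (A p))"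

global_interpretation op: vector_space op_scale
  by unfold_locales
    (auto simp: op_scale_def fun_eq_iff pm.scale_right_distrib pm.scale_left_distrib)


subsection \<open>The Lie algebras of an oriented tree diagram\<close>

text \<open>
  Differential operators with polynomial coefficients are identified with the linear
  operators by which they act on the polynomial ring (the action is faithful, the
  characteristic being 0).
\<close>

definition Var :: "'n \<Rightarrow> 'n mpoly" where
  "Var i = Poly_Mapping.single (Poly_Mapping.single i 1) 1"

text \<open>
  Partial derivative, monomial by monomial. The truncated subtraction of exponents is
  harmless: where it truncates, the coefficient is 0.
\<close>

definition partial :: "'n \<Rightarrow> 'n mpoly \<Rightarrow> 'n mpoly" where
  "partial i p = (\<Sum>m \<in> Poly_Mapping.keys p.
     Poly_Mapping.single (m - Poly_Mapping.single i 1)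
       (of_nat (Poly_Mapping.lookup m i) * Poly_Mapping.lookup p m))"

definition commutator ::
    "('n mpoly \<Rightarrow> 'n mpoly) \<Rightarrow> ('n mpoly \<Rightarrow> 'n mpoly) \<Rightarrow> ('n mpoly \<Rightarrow> 'n mpoly)" where
  "commutator A B = (A \<circ> B) - (B \<circ> A)"

definition lie_subalgebra :: "('n mpoly \<Rightarrow> 'n mpoly) set \<Rightarrow> bool" where
  "lie_subalgebra S \<longleftrightarrow> op.subspace S \<and> (\<forall>A \<in> S. \<forall>B \<in> S. commutator A B \<in> S)"

definition L0_generators ::
    "('n::{finite,linorder} \<times> 'n) set \<Rightarrow> ('n \<times> 'n \<Rightarrow> nat) \<Rightarrow> ('n mpoly \<Rightarrow> 'n mpoly) set" where
  "L0_generators E d = {partial i | i. i \<in> root_nodes E} \<union>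
     {(\<lambda>p. Var j ^ d (j, k) * partial k p) | j k. (j, k) \<in> E}"

definition L0 ::
    "('n::{finite,linorder} \<times> 'n) set \<Rightarrow> ('n \<times> 'n \<Rightarrow> nat) \<Rightarrow> ('n mpoly \<Rightarrow> 'n mpoly) set" where
  "L0 E d = lie_subalgebra hull (L0_generators E d)"

definition cartan :: "('n::{finite,linorder} mpoly \<Rightarrow> 'n mpoly) set" where
  "cartan = op.span {(\<lambda>p. Var i * partial i p) | i. True}"

definition L1 ::
    "('n::{finite,linorder} \<times> 'n) set \<Rightarrow> ('n \<times> 'n \<Rightarrow> nat) \<Rightarrow> ('n mpoly \<Rightarrow> 'n mpoly) set" where
  "L1 E d = cartan + L0 E d"


subsection \<open>Quotient spaces and isomorphism of graded vector spaces\<close>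

record 'a cvec_space =
  vcarrier :: "'a set"
  vadd :: "'a \<Rightarrow> 'a \<Rightarrow> 'a"
  vscale :: "complex \<Rightarrow> 'a \<Rightarrow> 'a"

text \<open>
  The quotient of a subspace \<open>Z\<close> by a subspace \<open>B\<close> of \<open>Z\<close>, with cosets
  as elements. In the scalar multiplication, adding \<open>B\<close> matters only for the scalar 0.
\<close>

definition quotient_space ::
    "(complex \<Rightarrow> 'a \<Rightarrow> 'a) \<Rightarrow> 'a::ab_group_add set \<Rightarrow> 'a set \<Rightarrow> 'a set cvec_space" where
  "quotient_space scl Z B =
     \<lparr> vcarrier = (\<lambda>x. x +o B) ` Z,
       vadd = (\<lambda>U V. U + V),
       vscale = (\<lambda>c U. scl c ` U + B) \<rparr>"

definition cvec_iso :: "'a cvec_space \<Rightarrow> 'b cvec_space \<Rightarrow> bool" where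
  "cvec_iso V W \<longleftrightarrow> (\<exists>f. bij_betw f (vcarrier V) (vcarrier W) \<and>
     (\<forall>u \<in> vcarrier V. \<forall>v \<in> vcarrier V. f (vadd V u v) = vadd W (f u) (f v)) \<and>
     (\<forall>c. \<forall>v \<in> vcarrier V. f (vscale V c v) = vscale W c (f v)))"

text \<open>
  A graded vector space is the family of its homogeneous components; an isomorphism of
  graded vector spaces is a degreewise linear isomorphism.
\<close>

definition graded_iso :: "(nat \<Rightarrow> 'a cvec_space) \<Rightarrow> (nat \<Rightarrow> 'b cvec_space) \<Rightarrow> bool" where
  "graded_iso V W \<longleftrightarrow> (\<forall>k. cvec_iso (V k) (W k))"


subsection \<open>Chevalley--Eilenberg cohomology with trivial coefficients\<close>

definition tuples :: "'v set \<Rightarrow> nat \<Rightarrow> 'v list set" where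
  "tuples L k = {xs. length xs = k \<and> set xs \<subseteq> L}"

text \<open>
  A \<open>k\<close>-cochain on the Lie algebra with carrier \<open>L\<close> is an alternating
  \<open>k\<close>-linear form on \<open>L\<close>. So that equality of cochains is equality of
  functions, it takes the value 0 on lists which are not \<open>k\<close>-tuples over \<open>L\<close>.
\<close>

definition cochains ::
    "(complex \<Rightarrow> 'v \<Rightarrow> 'v) \<Rightarrow> 'v::ab_group_add set \<Rightarrow> nat \<Rightarrow> ('v list \<Rightarrow> complex) set" where
  "cochains scl L k = {\<omega>.
     (\<forall>xs. xs \<notin> tuples L k \<longrightarrow> \<omega> xs = 0) \<and>
     (\<forall>xs \<in> tuples L k. \<forall>i < k. \<forall>x \<in> L. \<forall>y \<in> L. \<forall>c.
        \<omega> (xs[i := scl c x + y]) = c * \<omega> (xs[i := x]) + \<omega> (xs[i := y])) \<and>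
     (\<forall>xs \<in> tuples L k. \<forall>i j. i < j \<and> j < k \<and> xs ! i = xs ! j \<longrightarrow> \<omega> xs = 0)}"

text \<open>
  The differential
  $(d\omega)(x_0, \dots, x_k) = \sum_{i<j} (-1)^{i+j}
    \omega([x_i, x_j], x_0, \dots, \widehat{x_i}, \dots, \widehat{x_j}, \dots, x_k)$.
\<close>

definition ce_diff ::
    "('v \<Rightarrow> 'v \<Rightarrow> 'v) \<Rightarrow> 'v set \<Rightarrow> nat \<Rightarrow> ('v list \<Rightarrow> complex) \<Rightarrow> 'v list \<Rightarrow> complex" where
  "ce_diff br L k \<omega> xs =
     (if xs \<in> tuples L (Suc k)
      then \<Sum>(i, j) \<in> {(i, j). i < j \<and> j \<le> k}.
             (- 1) ^ (i + j) * \<omega> (br (xs ! i) (xs ! j) # nths xs (- {i, j}))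
      else 0)"

definition cocycles ::
    "(complex \<Rightarrow> 'v \<Rightarrow> 'v) \<Rightarrow> ('v \<Rightarrow> 'v \<Rightarrow> 'v) \<Rightarrow> 'v::ab_group_add set \<Rightarrow> nat
       \<Rightarrow> ('v list \<Rightarrow> complex) set" where
  "cocycles scl br L k = {\<omega> \<in> cochains scl L k. ce_diff br L k \<omega> = 0}"

definition coboundaries ::
    "(complex \<Rightarrow> 'v \<Rightarrow> 'v) \<Rightarrow> ('v \<Rightarrow> 'v \<Rightarrow> 'v) \<Rightarrow> 'v::ab_group_add set \<Rightarrow> nat
       \<Rightarrow> ('v list \<Rightarrow> complex) set" where
  "coboundaries scl br L k =
     (case k of 0 \<Rightarrow> {0} | Suc l \<Rightarrow> ce_diff br L l ` cochains scl L l)"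

definition ce_cohomology ::
    "(complex \<Rightarrow> 'v \<Rightarrow> 'v) \<Rightarrow> ('v \<Rightarrow> 'v \<Rightarrow> 'v) \<Rightarrow> 'v::ab_group_add set \<Rightarrow> nat
       \<Rightarrow> ('v list \<Rightarrow> complex) set cvec_space" where
  "ce_cohomology scl br L k =
     quotient_space (\<lambda>c \<omega> xs. c * \<omega> xs) (cocycles scl br L k) (coboundaries scl br L k)"


subsection \<open>Exterior powers\<close>

text \<open>
  The \<open>k\<close>-th exterior power of a subspace \<open>V\<close>: the free vector space on
  \<open>k\<close>-tuples over \<open>V\<close>, modulo the relations making the tuple
  $(v_1, \dots, v_k)$ multilinear and alternating.
\<close>

definition ext_relations ::
    "(complex \<Rightarrow> 'v \<Rightarrow> 'v) \<Rightarrow> 'v::ab_group_add set \<Rightarrow> nat \<Rightarrow> ('v list \<Rightarrow>\<^sub>0 complex) set" where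
  "ext_relations scl V k =
     {Poly_Mapping.single (xs[i := scl c x + y]) 1
        - pm_scale c (Poly_Mapping.single (xs[i := x]) 1)
        - Poly_Mapping.single (xs[i := y]) 1
      | xs i c x y. xs \<in> tuples V k \<and> i < k \<and> x \<in> V \<and> y \<in> V} \<union>
     {Poly_Mapping.single xs 1
      | xs i j. xs \<in> tuples V k \<and> i < j \<and> j < k \<and> xs ! i = xs ! j}"

definition ext_power ::
    "(complex \<Rightarrow> 'v \<Rightarrow> 'v) \<Rightarrow> 'v::ab_group_add set \<Rightarrow> nat
       \<Rightarrow> ('v list \<Rightarrow>\<^sub>0 complex) set cvec_space" where
  "ext_power scl V k =
     quotient_space pm_scale {F. Poly_Mapping.keys F \<subseteq> tuples V k}
       (pm.span (ext_relations scl V k))"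

end

theory Submission
  imports Defs "HOL-Library.Multiset"
begin

text \<open>
  Give the node \<open>i\<close> a positive integer weight \<open>w i\<close> such that \<open>w k > d (j, k) * w j\<close> along
  every edge \<open>(j, k)\<close>; this is possible because edges go from smaller to larger nodes. Let
  \<open>h\<close> be the sum of the operators \<open>w i x\<^sub>i \<partial>\<^sub>i\<close>, an element of the Cartan part. A root generator
  \<open>\<partial>\<^sub>i\<close> is an eigenvector of \<open>[h, -]\<close> with eigenvalue \<open>- w i\<close>, and the generator of an edge
  \<open>(j, k)\<close> has eigenvalue \<open>d (j, k) * w j - w k\<close>. All of these are negative, eigenvalues add
  under brackets, and a nonzero derivation of the polynomial ring cannot lower all weighted degrees
  by more than the largest \<open>w i\<close>. Hence \<open>L0\<close> is spanned by eigenvectors with eigenvalue \<open>-m\<close> for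
  \<open>1 \<le> m \<le> M\<close>, whereas \<open>[h, -]\<close> is zero on the Cartan part (\<open>L0_subset_span_bounded_parts\<close>).

  The Lie derivative along \<open>h\<close> multiplies the value of a cochain at a tuple of such
  eigenvectors by the total degree \<open>\<Sum>m\<close> of the tuple. By Cartan's formula it also maps cocycles
  to coboundaries. So the components of a cocycle of nonzero total degree can be removed without
  changing its class, and what remains is determined by the values at tuples from the Cartan part
  (\<open>cocycle_vanishing_in_degree_zero\<close>). Conversely, every alternating form on the Cartan part,
  extended by zero along \<open>L0\<close>, is a cocycle, because all brackets lie in \<open>L0\<close>; and a
  coboundary vanishes on the Cartan part, because this part is abelian. Thus the cohomology in
  degree \<open>k\<close> is the space of alternating \<open>k\<close>-forms on the Cartan part.

  That space and the \<open>k\<close>-th exterior power of the Cartan part are dual to each other. Both are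
  compared with a third space: the basis of operators \<open>x\<^sub>i \<partial>\<^sub>i\<close> gives each of them coordinates
  indexed by the strictly increasing lists of \<open>k\<close> nodes, and two quotients which are mapped onto
  the same space of coordinate functions, each with the divisor as kernel, are isomorphic
  (\<open>quotient_spaces_iso\<close>). The two kernels are computed in \<open>cohomology_iso_ext_power\<close>, for any
  Lie algebra with a grading of the kind just described.
\<close>

section \<open>Alternating forms\<close>

text \<open>
  The contraction of a form by a vector. A form of positive degree is determined by its
  contractions, so identities between forms can be proved by induction on the degree once one
  knows how the operations involved commute with contraction. The whole calculus below is obtained
  in this way.
\<close>

definition contract :: "'v \<Rightarrow> ('v list \<Rightarrow> complex) \<Rightarrow> 'v list \<Rightarrow> complex" where
  "contract x \<omega> = (\<lambda>xs. \<omega> (x # xs))"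

lemma contract_apply [simp]: "contract x \<omega> xs = \<omega> (x # xs)"
  by (simp add: contract_def)

locale form_space = vector_space scl
  for scl :: "complex \<Rightarrow> 'v::ab_group_add \<Rightarrow> 'v" +
  fixes L :: "'v set"
  assumes L_subspace: "subspace L"
begin

abbreviation "C \<equiv> cochains scl L"
abbreviation "T \<equiv> tuples L"

lemma L_add: "x \<in> L \<Longrightarrow> y \<in> L \<Longrightarrow> x + y \<in> L"
  and L_scale: "x \<in> L \<Longrightarrow> scl c x \<in> L"
  and L_zero: "0 \<in> L"
  using L_subspace by (auto simp: subspace_def)

lemma tuples_0 [simp]: "T 0 = {[]}"
  by (auto simp: tuples_def)

lemma Cons_in_tuples [simp]: "x # xs \<in> T (Suc k) \<longleftrightarrow> x \<in> L \<and> xs \<in> T k"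
  by (auto simp: tuples_def)

lemma Nil_in_tuples [simp]: "[] \<in> T k \<longleftrightarrow> k = 0"
  by (auto simp: tuples_def)

lemma tuples_SucE:
  assumes "xs \<in> T (Suc k)"
  obtains y ys where "xs = y # ys" "y \<in> L" "ys \<in> T k"
  using assms by (cases xs) auto

lemma cochain_outside: "\<omega> \<in> C k \<Longrightarrow> xs \<notin> T k \<Longrightarrow> \<omega> xs = 0"
  by (simp add: cochains_def)

lemma cochain_linear:
  "\<omega> \<in> C k \<Longrightarrow> xs \<in> T k \<Longrightarrow> i < k \<Longrightarrow> x \<in> L \<Longrightarrow> y \<in> L \<Longrightarrow>
     \<omega> (xs[i := scl c x + y]) = c * \<omega> (xs[i := x]) + \<omega> (xs[i := y])"
  by (simp add: cochains_def)

lemma cochain_alternating: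
  "\<omega> \<in> C k \<Longrightarrow> xs \<in> T k \<Longrightarrow> i < j \<Longrightarrow> j < k \<Longrightarrow> xs ! i = xs ! j \<Longrightarrow> \<omega> xs = 0"
  by (simp add: cochains_def) blast

lemma cochain_scale:
  assumes "\<omega> \<in> C k" "xs \<in> T k" "i < k" "x \<in> L"
  shows "\<omega> (xs[i := scl c x]) = c * \<omega> (xs[i := x])"
  using cochain_linear[OF assms(1-3), of 0 0 1] cochain_linear[OF assms(1-4), of 0 c] L_zero
  by simp

lemma cochain_add:
  assumes "\<omega> \<in> C k" "ps @ x # qs \<in> T k" "y \<in> L"
  shows "\<omega> (ps @ (x + y) # qs) = \<omega> (ps @ x # qs) + \<omega> (ps @ y # qs)"
  using cochain_linear[OF assms(1,2), of "length ps" x y 1] assms(2,3)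
  by (auto simp: tuples_def)

lemma cochains_zero: "0 \<in> C k"
  by (simp add: cochains_def)

lemma cochains_plus: "\<omega> \<in> C k \<Longrightarrow> \<eta> \<in> C k \<Longrightarrow> \<omega> + \<eta> \<in> C k"
  unfolding cochains_def mem_Collect_eq plus_fun_def by (simp add: algebra_simps)

lemma cochains_smult: "\<omega> \<in> C k \<Longrightarrow> (\<lambda>xs. a * \<omega> xs) \<in> C k"
  unfolding cochains_def mem_Collect_eq by (simp add: algebra_simps)

lemma cochains_minus: "\<omega> \<in> C k \<Longrightarrow> \<eta> \<in> C k \<Longrightarrow> \<omega> - \<eta> \<in> C k"
  using cochains_plus[of \<omega> k "\<lambda>xs. (-1) * \<eta> xs"] cochains_smult[of \<eta> k "-1"]
  by (simp add: plus_fun_def fun_diff_def)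

lemma cochains_sum: "(\<And>i. i \<in> I \<Longrightarrow> f i \<in> C k) \<Longrightarrow> (\<lambda>xs. \<Sum>i\<in>I. f i xs) \<in> C k"
proof (induction I rule: infinite_finite_induct)
  case (insert i I)
  then show ?case using cochains_plus[of "f i" k "\<lambda>xs. \<Sum>i\<in>I. f i xs"]
    by (simp add: plus_fun_def)
qed (use cochains_zero in \<open>simp_all add: zero_fun_def\<close>)

lemma cochain_swap:
  assumes \<omega>: "\<omega> \<in> C k" and xs: "ps @ x # y # qs \<in> T k"
  shows "\<omega> (ps @ y # x # qs) = - \<omega> (ps @ x # y # qs)"
proof -
  have L: "x \<in> L" "y \<in> L" using xs by (auto simp: tuples_def)
  have z: "\<omega> (ps @ u # u # qs) = 0" if "u \<in> L" for u
    by (rule cochain_alternating[OF \<omega>, where i = "length ps" and j = "Suc (length ps)"])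
      (use xs that in \<open>auto simp: tuples_def nth_append\<close>)
  have "0 = \<omega> (ps @ (x + y) # (x + y) # qs)"
    using z[of "x + y"] L L_add by simp
  also have "\<dots> = \<omega> (ps @ x # (x + y) # qs) + \<omega> (ps @ y # (x + y) # qs)"
    by (rule cochain_add[OF \<omega>]) (use xs L L_add in \<open>auto simp: tuples_def\<close>)
  also have "\<omega> (ps @ x # (x + y) # qs) = \<omega> (ps @ x # x # qs) + \<omega> (ps @ x # y # qs)"
    using cochain_add[OF \<omega>, of "ps @ [x]" x qs y] xs L by (auto simp: tuples_def)
  also have "\<omega> (ps @ y # (x + y) # qs) = \<omega> (ps @ y # x # qs) + \<omega> (ps @ y # y # qs)"
    using cochain_add[OF \<omega>, of "ps @ [y]" x qs y] xs L by (auto simp: tuples_def)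
  finally show ?thesis using z[OF L(1)] z[OF L(2)] by (simp add: add_eq_0_iff)
qed

text \<open>
  Moving an argument past \<open>length us\<close> others is a product of as many adjacent swaps.
\<close>

lemma cochain_move:
  assumes \<omega>: "\<omega> \<in> C k"
  shows "ps @ x # us @ vs \<in> T k \<Longrightarrow>
    \<omega> (ps @ x # us @ vs) = (-1) ^ length us * \<omega> (ps @ us @ x # vs)"
proof (induction us arbitrary: ps)
  case (Cons u us)
  have "\<omega> (ps @ x # u # us @ vs) = - \<omega> (ps @ u # x # us @ vs)"
    using cochain_swap[OF \<omega>, of ps u x "us @ vs"] Cons.prems by (auto simp: tuples_def)
  also have "\<omega> (ps @ u # x # us @ vs) = (-1) ^ length us * \<omega> (ps @ u # us @ x # vs)"
    using Cons.IH[of "ps @ [u]"] Cons.prems by (auto simp: tuples_def)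
  finally show ?case by simp
qed simp

lemma cochain_0I: "(\<And>xs. xs \<noteq> [] \<Longrightarrow> \<omega> xs = 0) \<Longrightarrow> \<omega> \<in> C 0"
  by (auto simp: cochains_def)

lemma cochain_outside_0: "\<omega> \<in> C 0 \<Longrightarrow> xs \<noteq> [] \<Longrightarrow> \<omega> xs = 0"
  by (auto simp: cochains_def)

lemma contract_cochain:
  assumes \<omega>: "\<omega> \<in> C (Suc k)" and x: "x \<in> L"
  shows "contract x \<omega> \<in> C k"
  unfolding cochains_def
proof (intro CollectI conjI allI ballI impI)
  fix xs assume "xs \<notin> T k"
  then show "contract x \<omega> xs = 0" using cochain_outside[OF \<omega>] by simp
next
  fix xs i y z c assume "xs \<in> T k" "i < k" "y \<in> L" "z \<in> L"
  then show "contract x \<omega> (xs[i := scl c y + z]) = c * contract x \<omega> (xs[i := y]) + contract x \<omega> (xs[i := z])"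
    using cochain_linear[OF \<omega>, of "x # xs" "Suc i" y z c] x by simp
next
  fix xs i j assume "xs \<in> T k" "i < j \<and> j < k \<and> xs ! i = xs ! j"
  then show "contract x \<omega> xs = 0"
    using cochain_alternating[OF \<omega>, of "x # xs" "Suc i" "Suc j"] x by simp
qed

lemma contract_linear:
  assumes \<omega>: "\<omega> \<in> C (Suc k)" and "x \<in> L" "y \<in> L"
  shows "contract (scl c x + y) \<omega> = (\<lambda>xs. c * contract x \<omega> xs) + contract y \<omega>"
proof
  fix xs show "contract (scl c x + y) \<omega> xs = ((\<lambda>xs. c * contract x \<omega> xs) + contract y \<omega>) xs"
    using cochain_linear[OF \<omega>, of "x # xs" 0 x y c] assms cochain_outside[OF \<omega>]
    by (cases "xs \<in> T k") auto
qed

lemma contract_contract_same: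
  assumes \<omega>: "\<omega> \<in> C (Suc k)" and "x \<in> L"
  shows "contract x (contract x \<omega>) = 0"
proof
  fix xs show "contract x (contract x \<omega>) xs = 0 xs"
    using cochain_alternating[OF \<omega>, of "x # x # xs" 0 1] assms cochain_outside[OF \<omega>, of "x # x # xs"]
    by (cases "x # x # xs \<in> T (Suc k)") (auto simp: tuples_def)
qed

text \<open>
  The recursive description of alternating forms by which cochains are recognized from here on.
  Beyond the properties of the contractions only linearity in the first slot and the vanishing on
  two equal leading arguments are left to check: an argument equal to the first one can be moved
  next to it inside a contraction.
\<close>

lemma cochain_SucI:
  assumes nil: "\<omega> [] = 0"
    and off: "\<And>x xs. x \<notin> L \<Longrightarrow> \<omega> (x # xs) = 0"
    and contract: "\<And>x. x \<in> L \<Longrightarrow> contract x \<omega> \<in> C k"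
    and lin: "\<And>x y c. x \<in> L \<Longrightarrow> y \<in> L \<Longrightarrow> contract (scl c x + y) \<omega> = (\<lambda>xs. c * contract x \<omega> xs) + contract y \<omega>"
    and alt: "\<And>x. x \<in> L \<Longrightarrow> contract x (contract x \<omega>) = 0"
  shows "\<omega> \<in> C (Suc k)"
  unfolding cochains_def
proof (intro CollectI conjI allI ballI impI)
  fix xs assume "xs \<notin> T (Suc k)"
  then show "\<omega> xs = 0"
    using nil off cochain_outside[OF contract, unfolded contract_apply] by (cases xs) (simp, metis Cons_in_tuples)
next
  fix xs i y z c assume xs: "xs \<in> T (Suc k)" and i: "i < Suc k" and yz: "y \<in> L" "z \<in> L"
  obtain x ys where [simp]: "xs = x # ys" "x \<in> L" "ys \<in> T k" using tuples_SucE[OF xs] .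
  show "\<omega> (xs[i := scl c y + z]) = c * \<omega> (xs[i := y]) + \<omega> (xs[i := z])"
  proof (cases i)
    case 0
    then show ?thesis using fun_cong[OF lin[OF yz, of c], of ys] by simp
  next
    case (Suc j)
    then show ?thesis using cochain_linear[OF contract, of x ys j y z c] i yz by simp
  qed
next
  fix xs i j assume xs: "xs \<in> T (Suc k)" and ij: "i < j \<and> j < Suc k \<and> xs ! i = xs ! j"
  obtain x ys where xy [simp]: "xs = x # ys" "x \<in> L" "ys \<in> T k" using tuples_SucE[OF xs] .
  obtain l where j: "j = Suc l" "l < k" using ij by (cases j) auto
  show "\<omega> xs = 0"
  proof (cases i)
    case 0
    then have "x = ys ! l" using ij j by simp
    then have ys: "ys = take l ys @ x # drop (Suc l) ys"
      using xy(3) j by (simp add: tuples_def id_take_nth_drop[symmetric])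
    have t: "x # take l ys @ drop (Suc l) ys \<in> T k"
      using xy(3) by (subst (asm) ys) (auto simp: tuples_def)
    have "(-1) ^ l * contract x \<omega> ys = contract x \<omega> (x # take l ys @ drop (Suc l) ys)"
      using cochain_move[OF contract, of x "[]" x "take l ys" "drop (Suc l) ys"] t ys j xy(3)
      by (simp add: tuples_def)
    also have "\<dots> = 0" using fun_cong[OF alt[OF xy(2)], of "take l ys @ drop (Suc l) ys"] by simp
    finally show ?thesis by simp
  next
    case (Suc m)
    then show ?thesis using cochain_alternating[OF contract, of x ys m l] ij j by simp
  qed
qed

lemma contract_plus: "\<omega> \<in> C (Suc k) \<Longrightarrow> x \<in> L \<Longrightarrow> y \<in> L \<Longrightarrow> contract (x + y) \<omega> = contract x \<omega> + contract y \<omega>"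
  using contract_linear[of \<omega> k x y 1] by (simp add: fun_eq_iff)

lemma contract_zero: "\<omega> \<in> C (Suc k) \<Longrightarrow> contract 0 \<omega> = 0"
  using contract_plus[of \<omega> k 0 0] L_zero by (simp add: fun_eq_iff)

lemma contract_diff:
  assumes "\<omega> \<in> C (Suc k)" "x \<in> L" "y \<in> L"
  shows "contract (x - y) \<omega> = contract x \<omega> - contract y \<omega>"
proof -
  have "x - y \<in> L" using assms subspace_diff[OF L_subspace] by blast
  from contract_plus[OF assms(1) this assms(3)] show ?thesis by simp
qed

lemma contract_contract_swap:
  assumes \<omega>: "\<omega> \<in> C (Suc k)" and x: "x \<in> L" and y: "y \<in> L"
  shows "contract x (contract y \<omega>) = - contract y (contract x \<omega>)"
proof
  fix xs show "contract x (contract y \<omega>) xs = (- contract y (contract x \<omega>)) xs"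
  proof (cases "x # y # xs \<in> T (Suc k)")
    case True
    then show ?thesis using cochain_swap[OF \<omega>, of "[]" x y xs] by simp
  next
    case False
    then have "y # x # xs \<notin> T (Suc k)" by (auto simp: tuples_def)
    with False show ?thesis using cochain_outside[OF \<omega>] by simp
  qed
qed

lemma fun_eqI_contract:
  assumes "\<And>xs. xs \<notin> T (Suc k) \<Longrightarrow> F xs = 0" "\<And>xs. xs \<notin> T (Suc k) \<Longrightarrow> G xs = 0"
    and "\<And>x. x \<in> L \<Longrightarrow> contract x F = contract x G"
  shows "F = G"
proof
  fix xs show "F xs = G xs"
  proof (cases "xs \<in> T (Suc k)")
    case True
    then obtain x ys where "xs = x # ys" "x \<in> L" by (elim tuples_SucE)
    then show ?thesis using fun_cong[OF assms(3), of x ys] by simp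
  qed (simp add: assms)
qed

text \<open>
  By multilinearity a form is determined by its values at tuples from a spanning set; the slots
  are treated one after the other.
\<close>

lemma cochain_eq_zero_on_span:
  assumes B: "B \<subseteq> L" "L \<subseteq> span B"
  shows "\<omega> \<in> C k \<Longrightarrow> (\<And>xs. xs \<in> tuples B k \<Longrightarrow> \<omega> xs = 0) \<Longrightarrow> \<omega> = 0"
proof (induction k arbitrary: \<omega>)
  case 0
  have "\<omega> xs = 0" for xs
    using cochain_outside_0[OF 0(1), of xs] 0(2)[of "[]"] by (cases xs) (simp_all add: tuples_def)
  then show ?case by (simp add: fun_eq_iff)
next
  case (Suc k)
  have b: "contract x \<omega> = 0" if "x \<in> B" for x
  proof (rule Suc.IH[OF contract_cochain[OF Suc.prems(1)]])
    show "x \<in> L" using that B by blast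
    show "contract x \<omega> xs = 0" if "xs \<in> tuples B k" for xs
      using Suc.prems(2)[of "x # xs"] that \<open>x \<in> B\<close> by (simp add: tuples_def)
  qed
  have sp: "x \<in> L \<and> contract x \<omega> = 0" if "x \<in> span B" for x
    using that
  proof (induction rule: span_induct_alt)
    case base
    show ?case using L_zero contract_zero[OF Suc.prems(1)] by simp
  next
    case (step c x y)
    have "x \<in> L" using step(1) B by blast
    then show ?case using contract_linear[OF Suc.prems(1), of x y c] b[OF step(1)] step(2)
        L_add[OF L_scale[of x c], of y] by (simp add: fun_eq_iff)
  qed
  show ?case
  proof (rule fun_eqI_contract)
    show "\<omega> xs = 0" if "xs \<notin> T (Suc k)" for xs by (rule cochain_outside[OF Suc.prems(1) that])
    show "contract x \<omega> = contract x 0" if "x \<in> L" for x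
      using sp[of x] that B by (auto simp: fun_eq_iff)
  qed simp
qed

text \<open>
  Permuting the arguments changes a form only by a sign. Only the vanishing is recorded; the
  prefix \<open>ps\<close> consists of the arguments already in place, which makes the induction work.
\<close>

lemma cochain_permute_zero:
  assumes \<omega>: "\<omega> \<in> C k"
  shows "mset xs = mset ys \<Longrightarrow> ps @ xs \<in> T k \<Longrightarrow> \<omega> (ps @ ys) = 0 \<Longrightarrow> \<omega> (ps @ xs) = 0"
proof (induction xs arbitrary: ys ps)
  case (Cons x xs)
  have "x \<in> set ys" using Cons.prems(1) by (metis list.set_intros(1) set_mset_mset)
  then obtain us vs where ys: "ys = us @ x # vs" by (meson split_list)
  then have m: "mset xs = mset (us @ vs)" using Cons.prems(1) by simp
  then have "length xs = length (us @ vs)" "set xs = set (us @ vs)"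
    by (metis size_mset) (use m in \<open>metis set_mset_mset\<close>)
  then have "ps @ x # us @ vs \<in> T k" using Cons.prems(2) by (auto simp: tuples_def)
  then have "\<omega> ((ps @ [x]) @ us @ vs) = 0"
    using cochain_move[OF \<omega>, of ps x us vs] Cons.prems(3) ys by simp
  then show ?case using Cons.IH[OF m, of "ps @ [x]"] Cons.prems(2) by simp
qed simp

end

section \<open>Cartan calculus for the Chevalley--Eilenberg differential\<close>

lemma (in form_space) contract_cochain_0: "\<omega> \<in> C 0 \<Longrightarrow> contract x \<omega> = 0"
  by (simp add: fun_eq_iff cochain_outside_0)

locale lie_algebra = form_space scl L
  for scl :: "complex \<Rightarrow> 'v::ab_group_add \<Rightarrow> 'v" and L :: "'v set" +
  fixes br :: "'v \<Rightarrow> 'v \<Rightarrow> 'v"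
  assumes br_closed: "x \<in> L \<Longrightarrow> y \<in> L \<Longrightarrow> br x y \<in> L"
    and br_linear_right: "x \<in> L \<Longrightarrow> y \<in> L \<Longrightarrow> z \<in> L \<Longrightarrow> br x (scl c y + z) = scl c (br x y) + br x z"
    and br_self: "x \<in> L \<Longrightarrow> br x x = 0"
    and br_skew: "x \<in> L \<Longrightarrow> y \<in> L \<Longrightarrow> br y x = - br x y"
    and jacobi: "x \<in> L \<Longrightarrow> y \<in> L \<Longrightarrow> z \<in> L \<Longrightarrow> br x (br y z) = br (br x y) z + br y (br x z)"
begin

lemma br_linear_left:
  assumes "x \<in> L" "y \<in> L" "z \<in> L"
  shows "br (scl c y + z) x = scl c (br y x) + br z x"
  using br_linear_right[OF assms, of c] br_skew[OF assms(1), of "scl c y + z"] br_skew[OF assms(1,2)]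
    br_skew[OF assms(1,3)] L_add[OF L_scale[OF assms(2)] assms(3)] by simp

text \<open>
  The minus sign is that of the coadjoint action. The guard makes the Lie derivative of a cochain
  vanish outside the tuples over \<open>L\<close>, as cochains do: without it, a bracket could bring an entry
  from outside back into \<open>L\<close>.
\<close>

definition lie_deriv :: "'v \<Rightarrow> ('v list \<Rightarrow> complex) \<Rightarrow> 'v list \<Rightarrow> complex" where
  "lie_deriv x \<omega> = (\<lambda>xs. if set xs \<subseteq> L then - (\<Sum>l<length xs. \<omega> (xs[l := br x (xs ! l)])) else 0)"

abbreviation "D \<equiv> ce_diff br L"

lemma lie_deriv_plus: "lie_deriv x (\<omega> + \<eta>) = lie_deriv x \<omega> + lie_deriv x \<eta>"
  and lie_deriv_minus: "lie_deriv x (\<omega> - \<eta>) = lie_deriv x \<omega> - lie_deriv x \<eta>"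
  and lie_deriv_smult: "lie_deriv x (\<lambda>xs. c * \<omega> xs) = (\<lambda>xs. c * lie_deriv x \<omega> xs)"
  and lie_deriv_zero: "lie_deriv x 0 = 0"
  by (auto simp: lie_deriv_def fun_eq_iff sum.distrib sum_subtractf sum_distrib_left)

lemma cochain_outside_L: "\<omega> \<in> C k \<Longrightarrow> \<not> set xs \<subseteq> L \<Longrightarrow> \<omega> xs = 0"
  by (rule cochain_outside) (auto simp: tuples_def)

lemma lie_deriv_cochain_0: "\<omega> \<in> C 0 \<Longrightarrow> lie_deriv x \<omega> = 0"
  by (auto simp: lie_deriv_def fun_eq_iff intro!: sum.neutral cochain_outside_0[of \<omega>])

text \<open>
  The commutation rule of Lie derivative and contraction: among the terms of the Lie derivative,
  the one which replaces the contracted argument \<open>y\<close> is \<open>- contract (br x y) \<omega>\<close>.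
\<close>

lemma contract_lie_deriv:
  assumes \<omega>: "\<omega> \<in> C k" and y: "y \<in> L"
  shows "contract y (lie_deriv x \<omega>) = lie_deriv x (contract y \<omega>) - contract (br x y) \<omega>"
proof
  fix ys
  show "contract y (lie_deriv x \<omega>) ys = (lie_deriv x (contract y \<omega>) - contract (br x y) \<omega>) ys"
  proof (cases "set ys \<subseteq> L")
    case True
    then show ?thesis using y by (simp add: lie_deriv_def sum.lessThan_Suc_shift del: sum.lessThan_Suc)
  next
    case False
    then show ?thesis using cochain_outside_L[OF \<omega>, of "br x y # ys"] by (simp add: lie_deriv_def)
  qed
qed

lemma lie_deriv_cochain: "\<omega> \<in> C k \<Longrightarrow> x \<in> L \<Longrightarrow> lie_deriv x \<omega> \<in> C k"
proof (induction k arbitrary: \<omega>)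
  case 0
  then show ?case using cochains_zero lie_deriv_cochain_0 by metis
next
  case (Suc k)
  note \<omega> = Suc.prems(1) and x = Suc.prems(2)
  note il = contract_lie_deriv[OF \<omega>]
  show ?case
  proof (rule cochain_SucI)
    fix y assume y: "y \<in> L"
    show "contract y (lie_deriv x \<omega>) \<in> C k"
      unfolding il[OF y] by (intro cochains_minus Suc.IH contract_cochain[OF \<omega>] x y br_closed)
    have "contract y (contract y (lie_deriv x \<omega>)) =
        contract y (lie_deriv x (contract y \<omega>)) - contract y (contract (br x y) \<omega>)"
      using y by (simp add: il fun_eq_iff)
    also have "\<dots> = 0"
      using contract_lie_deriv[OF contract_cochain[OF \<omega> y] y, of x] contract_contract_same[OF \<omega> y]
        contract_contract_swap[OF \<omega> y br_closed[OF x y]] by (simp add: lie_deriv_zero)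
    finally show "contract y (contract y (lie_deriv x \<omega>)) = 0" .
    fix z c assume z: "z \<in> L"
    have cyz: "scl c y + z \<in> L" using y z L_add L_scale by blast
    have "contract (scl c y + z) (lie_deriv x \<omega>) =
        lie_deriv x ((\<lambda>xs. c * contract y \<omega> xs) + contract z \<omega>) - contract (scl c (br x y) + br x z) \<omega>"
      using contract_linear[OF \<omega> y z, of c] br_linear_right[OF x y z, of c] il[OF cyz] by simp
    also have "\<dots> = (\<lambda>xs. c * contract y (lie_deriv x \<omega>) xs) + contract z (lie_deriv x \<omega>)"
      unfolding contract_linear[OF \<omega> br_closed[OF x y] br_closed[OF x z]] lie_deriv_plus lie_deriv_smult
        il[OF y] il[OF z] by (simp add: fun_eq_iff algebra_simps del: contract_apply)
    finally show "contract (scl c y + z) (lie_deriv x \<omega>) =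
        (\<lambda>xs. c * contract y (lie_deriv x \<omega>) xs) + contract z (lie_deriv x \<omega>)" .
  qed (simp_all add: lie_deriv_def)
qed

lemma lie_deriv_linear_left:
  assumes \<omega>: "\<omega> \<in> C k" and x: "x \<in> L" and y: "y \<in> L"
  shows "lie_deriv (scl c x + y) \<omega> = (\<lambda>xs. c * lie_deriv x \<omega> xs) + lie_deriv y \<omega>"
proof
  fix xs
  show "lie_deriv (scl c x + y) \<omega> xs = ((\<lambda>xs. c * lie_deriv x \<omega> xs) + lie_deriv y \<omega>) xs"
  proof (cases "xs \<in> T k")
    case True
    have "\<omega> (xs[l := br (scl c x + y) (xs ! l)]) =
        c * \<omega> (xs[l := br x (xs ! l)]) + \<omega> (xs[l := br y (xs ! l)])" if "l < length xs" for l
    proof -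
      have l: "xs ! l \<in> L" using True that nth_mem[OF that] by (auto simp: tuples_def)
      then show ?thesis
        using cochain_linear[OF \<omega> True, of l "br x (xs ! l)" "br y (xs ! l)" c] that True
          br_linear_left[OF l x y, of c] br_closed x y by (simp add: tuples_def)
    qed
    then show ?thesis by (simp add: lie_deriv_def sum.distrib sum_distrib_left)
  next
    case False
    have "lie_deriv z \<omega> xs = 0" for z
      using cochain_outside[OF \<omega>] False by (auto simp: lie_deriv_def tuples_def intro!: sum.neutral)
    then show ?thesis by simp
  qed
qed

text \<open>
  Forms are a representation of the Lie algebra. After contraction by \<open>z\<close>, the mixed terms are
  symmetric in \<open>x\<close> and \<open>y\<close> and cancel, and the remaining ones combine by the Jacobi identity.
\<close>

lemma lie_deriv_commutator:
  "\<omega> \<in> C k \<Longrightarrow> x \<in> L \<Longrightarrow> y \<in> L \<Longrightarrow>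
     lie_deriv x (lie_deriv y \<omega>) - lie_deriv y (lie_deriv x \<omega>) = lie_deriv (br x y) \<omega>"
proof (induction k arbitrary: \<omega>)
  case 0
  then show ?case unfolding lie_deriv_cochain_0[OF 0(1)] lie_deriv_zero by simp
next
  case (Suc k)
  note \<omega> = Suc.prems(1) and x = Suc.prems(2) and y = Suc.prems(3)
  note lx = lie_deriv_cochain[OF \<omega> x] and ly = lie_deriv_cochain[OF \<omega> y]
  show ?case
  proof (rule fun_eqI_contract)
    show "lie_deriv (br x y) \<omega> xs = 0" if "xs \<notin> T (Suc k)" for xs
      using cochain_outside[OF lie_deriv_cochain[OF \<omega> br_closed[OF x y]] that] .
    show "(lie_deriv x (lie_deriv y \<omega>) - lie_deriv y (lie_deriv x \<omega>)) xs = 0" if "xs \<notin> T (Suc k)" for xs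
      using cochain_outside[OF cochains_minus[OF lie_deriv_cochain[OF ly x] lie_deriv_cochain[OF lx y]] that] .
    fix z assume z: "z \<in> L"
    note iz = contract_cochain[OF \<omega> z]
    have e: "contract z (lie_deriv u (lie_deriv v \<omega>)) =
        lie_deriv u (lie_deriv v (contract z \<omega>)) - lie_deriv u (contract (br v z) \<omega>) - lie_deriv v (contract (br u z) \<omega>)
        + contract (br v (br u z)) \<omega>" if u: "u \<in> L" and v: "v \<in> L" for u v
      using contract_lie_deriv[OF lie_deriv_cochain[OF \<omega> v] z, of u] contract_lie_deriv[OF \<omega> z, of v]
        contract_lie_deriv[OF \<omega> br_closed[OF u z], of v] by (simp add: lie_deriv_minus)
    have j: "br x (br y z) - br y (br x z) = br (br x y) z"
      using jacobi[OF x y z] by simp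
    have "contract z (lie_deriv x (lie_deriv y \<omega>) - lie_deriv y (lie_deriv x \<omega>)) =
        contract z (lie_deriv x (lie_deriv y \<omega>)) - contract z (lie_deriv y (lie_deriv x \<omega>))"
      by (simp add: fun_eq_iff)
    also have "\<dots> = (lie_deriv x (lie_deriv y (contract z \<omega>)) - lie_deriv y (lie_deriv x (contract z \<omega>)))
        - (contract (br x (br y z)) \<omega> - contract (br y (br x z)) \<omega>)"
      by (simp add: e x y)
    also have "\<dots> = lie_deriv (br x y) (contract z \<omega>) - contract (br (br x y) z) \<omega>"
      unfolding Suc.IH[OF iz x y] j[symmetric]
      by (subst contract_diff[OF \<omega>]) (simp_all add: x y z br_closed)
    also have "\<dots> = contract z (lie_deriv (br x y) \<omega>)"
      using contract_lie_deriv[OF \<omega> z, of "br x y"] by simp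
    finally show "contract z (lie_deriv x (lie_deriv y \<omega>) - lie_deriv y (lie_deriv x \<omega>)) = contract z (lie_deriv (br x y) \<omega>)" .
  qed
qed

lemma D_outside: "xs \<notin> T (Suc k) \<Longrightarrow> D k \<omega> xs = 0"
  by (simp add: ce_diff_def)

lemma D_plus: "D k (\<omega> + \<eta>) = D k \<omega> + D k \<eta>"
  and D_minus: "D k (\<omega> - \<eta>) = D k \<omega> - D k \<eta>"
  and D_smult: "D k (\<lambda>xs. c * \<omega> xs) = (\<lambda>xs. c * D k \<omega> xs)"
  and D_zero: "D k 0 = 0"
  by (auto simp: ce_diff_def fun_eq_iff split_def sum.distrib sum_subtractf sum_distrib_left
      algebra_simps)

lemma D_0: "D 0 \<omega> = 0"
proof -
  have e: "{(i, j). i < j \<and> j \<le> (0::nat)} = {}" by auto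
  show ?thesis unfolding ce_diff_def e by (simp add: fun_eq_iff)
qed

lemma nths_Cons_delete:
  "nths (x # xs) (- {0, Suc j}) = nths xs (- {j})"
  "nths (x # xs) (- {Suc i, Suc j}) = x # nths xs (- {i, j})"
proof -
  have "{l. Suc l \<in> - {0, Suc j}} = - {j}" "{l. Suc l \<in> - {Suc i, Suc j}} = - {i, j}" by auto
  then show "nths (x # xs) (- {0, Suc j}) = nths xs (- {j})"
    "nths (x # xs) (- {Suc i, Suc j}) = x # nths xs (- {i, j})"
    by (simp_all add: nths_Cons)
qed

lemma nths_delete: "j < length xs \<Longrightarrow> nths xs (- {j}) = take j xs @ drop (Suc j) xs"
proof (induction xs arbitrary: j)
  case (Cons x xs)
  show ?case
  proof (cases j)
    case 0
    have "{l. Suc l \<in> - {0::nat}} = UNIV" by auto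
    then show ?thesis using 0 by (simp add: nths_Cons nths_all)
  next
    case (Suc i)
    have "{l. Suc l \<in> - {Suc i}} = - {i}" by auto
    then show ?thesis using Suc Cons by (simp add: nths_Cons)
  qed
qed simp

text \<open>
  Cartan's formula. In the sum over pairs \<open>i < j\<close> that defines the differential at
  \<open>x # xs\<close>, the pairs with \<open>i = 0\<close> are the brackets with \<open>x\<close>: moving each of them from the front
  back to its place costs a sign \<open>(-1)^(j-1)\<close> and gives the Lie derivative. In the other pairs
  \<open>x\<close> is a spectator in second position; swapping it to the front costs one sign and gives the
  differential of the contraction.
\<close>

lemma contract_D:
  assumes \<omega>: "\<omega> \<in> C (Suc k)" and x: "x \<in> L"
  shows "contract x (D (Suc k) \<omega>) = lie_deriv x \<omega> - D k (contract x \<omega>)"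
proof
  fix xs
  show "contract x (D (Suc k) \<omega>) xs = (lie_deriv x \<omega> - D k (contract x \<omega>)) xs"
  proof (cases "xs \<in> T (Suc k)")
    case False
    then show ?thesis using cochain_outside[OF lie_deriv_cochain[OF \<omega> x]] D_outside by (simp add: D_outside)
  next
    case True
    then have len: "length xs = Suc k" and sub: "set xs \<subseteq> L" by (auto simp: tuples_def)
    let ?P = "{(i, j). i < j \<and> j \<le> k}"
    let ?t = "\<lambda>(i, j). (-1) ^ (i + j) *
      \<omega> (br ((x # xs) ! i) ((x # xs) ! j) # nths (x # xs) (- {i, j}))"
    let ?a = "\<lambda>j::nat. (0::nat, Suc j)" and ?b = "\<lambda>(i, j). (Suc i, Suc j)"
    have fin: "finite ?P" by (rule finite_subset[of _ "{..k} \<times> {..k}"]) auto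
    have split: "{(i, j). i < j \<and> j \<le> Suc k} = ?a ` {..<Suc k} \<union> ?b ` ?P" (is "?l = ?r")
    proof
      show "?l \<subseteq> ?r"
      proof safe
        fix i j assume ij: "i < j" "j \<le> Suc k" "(i, j) \<notin> ?b ` ?P"
        obtain j' where j': "j = Suc j'" using ij by (cases j) auto
        show "(i, j) \<in> ?a ` {..<Suc k}"
        proof (cases i)
          case (Suc i')
          then have "(i, j) = ?b (i', j')" "(i', j') \<in> ?P" using ij j' by auto
          then show ?thesis using ij(3) by blast
        qed (use ij j' in auto)
      qed
    qed auto
    have "D (Suc k) \<omega> (x # xs) = sum ?t ?l"
      using True x by (simp add: ce_diff_def)
    also have "\<dots> = sum ?t (?a ` {..<Suc k}) + sum ?t (?b ` ?P)"
      unfolding split by (rule sum.union_disjoint) (use fin in auto)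
    also have "sum ?t (?a ` {..<Suc k}) = sum (?t \<circ> ?a) {..<Suc k}"
      by (rule sum.reindex) (auto simp: inj_on_def)
    also have "\<dots> = lie_deriv x \<omega> xs"
    proof -
      have "(-1) ^ Suc j * \<omega> (br x (xs ! j) # nths xs (- {j})) = - \<omega> (xs[j := br x (xs ! j)])"
        if j: "j < Suc k" for j
      proof -
        have b: "br x (xs ! j) \<in> L" using sub j len nth_mem[of j xs] by (intro br_closed x) auto
        have "br x (xs ! j) # take j xs @ drop (Suc j) xs \<in> T (Suc k)"
          using b sub j len set_take_subset[of j xs] set_drop_subset[of "Suc j" xs]
          by (auto simp: tuples_def)
        then have "\<omega> (br x (xs ! j) # take j xs @ drop (Suc j) xs) =
            (-1) ^ j * \<omega> (xs[j := br x (xs ! j)])"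
          using cochain_move[OF \<omega>, of "[]" "br x (xs ! j)" "take j xs" "drop (Suc j) xs"] j len
          by (simp add: upd_conv_take_nth_drop)
        then show ?thesis
          using j len by (simp add: nths_delete power_mult_distrib[symmetric])
      qed
      then show ?thesis
        using sub by (simp add: lie_deriv_def len nths_Cons_delete sum_negf[symmetric])
    qed
    also have "sum ?t (?b ` ?P) = sum (?t \<circ> ?b) ?P"
      by (rule sum.reindex) (auto simp: inj_on_def)
    also have "\<dots> = - D k (contract x \<omega>) xs"
    proof -
      have "\<omega> (br (xs ! i) (xs ! j) # x # nths xs (- {i, j})) =
          - \<omega> (x # br (xs ! i) (xs ! j) # nths xs (- {i, j}))" if "i < j" "j \<le> k" for i j
      proof -
        have "xs ! i \<in> L" "xs ! j \<in> L" using sub len nth_mem[of i xs] nth_mem[of j xs] that by auto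
        then show ?thesis
          using fun_cong[OF contract_contract_swap[OF \<omega> br_closed x, of "xs ! i" "xs ! j"]] by simp
      qed
      then show ?thesis
        using True by (auto simp: ce_diff_def nths_Cons_delete sum_negf[symmetric] intro!: sum.cong)
    qed
    finally show ?thesis by simp
  qed
qed

text \<open>
  That the differential of a form alternates comes down to the case of two equal leading
  arguments \<open>x\<close>, where Cartan's formula and \<open>br x x = 0\<close> make the two terms cancel.
\<close>

lemma D_cochain: "\<omega> \<in> C k \<Longrightarrow> D k \<omega> \<in> C (Suc k)"
proof (induction k arbitrary: \<omega>)
  case 0
  show ?case unfolding D_0 by (rule cochains_zero)
next
  case (Suc k)
  note \<omega> = Suc.prems
  show ?case
  proof (rule cochain_SucI)
    fix x assume x: "x \<in> L"
    show "contract x (D (Suc k) \<omega>) \<in> C (Suc k)"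
      unfolding contract_D[OF \<omega> x]
      by (rule cochains_minus[OF lie_deriv_cochain[OF \<omega> x] Suc.IH[OF contract_cochain[OF \<omega> x]]])
    have "contract x (contract x (D (Suc k) \<omega>)) = contract x (lie_deriv x \<omega>) - contract x (D k (contract x \<omega>))"
      unfolding contract_D[OF \<omega> x] by (simp add: fun_eq_iff)
    also have "contract x (lie_deriv x \<omega>) = lie_deriv x (contract x \<omega>)"
      using contract_lie_deriv[OF \<omega> x, of x] contract_zero[OF \<omega>] br_self[OF x] by simp
    also have "lie_deriv x (contract x \<omega>) - contract x (D k (contract x \<omega>)) = 0"
    proof (cases k)
      case 0
      then show ?thesis
        using lie_deriv_cochain_0[of "contract x \<omega>"] contract_cochain[OF \<omega> x] by (simp add: D_0 fun_eq_iff)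
    next
      case (Suc m)
      then show ?thesis
        using contract_D[of "contract x \<omega>" m x] contract_cochain[OF \<omega> x] x contract_contract_same[OF \<omega> x]
        by (simp add: D_zero)
    qed
    finally show "contract x (contract x (D (Suc k) \<omega>)) = 0" .
    fix y c assume y: "y \<in> L"
    have cxy: "scl c x + y \<in> L" using x y L_add L_scale by blast
    show "contract (scl c x + y) (D (Suc k) \<omega>) =
        (\<lambda>xs. c * contract x (D (Suc k) \<omega>) xs) + contract y (D (Suc k) \<omega>)"
      unfolding contract_D[OF \<omega> x] contract_D[OF \<omega> y] contract_D[OF \<omega> cxy] contract_linear[OF \<omega> x y]
        lie_deriv_linear_left[OF \<omega> x y] D_plus D_smult
      by (simp add: fun_eq_iff algebra_simps del: contract_apply)
  qed (simp_all add: D_outside)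
qed

text \<open>
  The differential is equivariant. Contracting both sides reduces the claim to
  \<open>lie_deriv_commutator\<close> and to lower degree.
\<close>

lemma D_lie_deriv: "\<omega> \<in> C k \<Longrightarrow> x \<in> L \<Longrightarrow> D k (lie_deriv x \<omega>) = lie_deriv x (D k \<omega>)"
proof (induction k arbitrary: \<omega>)
  case 0
  show ?case unfolding D_0 lie_deriv_zero ..
next
  case (Suc k)
  note \<omega> = Suc.prems(1) and x = Suc.prems(2)
  show ?case
  proof (rule fun_eqI_contract)
    show "lie_deriv x (D (Suc k) \<omega>) xs = 0" if "xs \<notin> T (Suc (Suc k))" for xs
      using cochain_outside[OF lie_deriv_cochain[OF D_cochain[OF \<omega>] x] that] .
    fix y assume y: "y \<in> L"
    have "contract y (D (Suc k) (lie_deriv x \<omega>)) =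
        lie_deriv y (lie_deriv x \<omega>) - (lie_deriv x (D k (contract y \<omega>)) - D k (contract (br x y) \<omega>))"
      unfolding Suc.IH[OF contract_cochain[OF \<omega> y] x, symmetric]
      by (simp add: contract_D[OF lie_deriv_cochain[OF \<omega> x] y] contract_lie_deriv[OF \<omega> y] D_minus)
    also have "\<dots> = lie_deriv x (lie_deriv y \<omega>) - lie_deriv x (D k (contract y \<omega>))
        - (lie_deriv (br x y) \<omega> - D k (contract (br x y) \<omega>))"
      using lie_deriv_commutator[OF \<omega> x y, symmetric] by simp
    also have "\<dots> = contract y (lie_deriv x (D (Suc k) \<omega>))"
      by (simp add: contract_lie_deriv[OF D_cochain[OF \<omega>] y] contract_D[OF \<omega> y] contract_D[OF \<omega> br_closed[OF x y]]
          lie_deriv_minus)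
    finally show "contract y (D (Suc k) (lie_deriv x \<omega>)) = contract y (lie_deriv x (D (Suc k) \<omega>))" .
  qed (simp add: D_outside)
qed

text \<open>
  By Cartan's formula, a contraction of the iterated differential is an iterated differential in
  lower degree, up to the commutator of differential and Lie derivative, which vanishes.
\<close>

lemma D_D: "\<omega> \<in> C k \<Longrightarrow> D (Suc k) (D k \<omega>) = 0"
proof (induction k arbitrary: \<omega>)
  case 0
  show ?case unfolding D_0 D_zero ..
next
  case (Suc k)
  note \<omega> = Suc.prems
  show ?case
  proof (rule fun_eqI_contract[where k = "Suc (Suc k)"])
    fix x assume x: "x \<in> L"
    have "contract x (D (Suc (Suc k)) (D (Suc k) \<omega>)) =
        lie_deriv x (D (Suc k) \<omega>) - D (Suc k) (lie_deriv x \<omega> - D k (contract x \<omega>))"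
      by (simp add: contract_D[OF D_cochain[OF \<omega>] x] contract_D[OF \<omega> x])
    also have "\<dots> = 0"
      unfolding D_minus D_lie_deriv[OF \<omega> x] Suc.IH[OF contract_cochain[OF \<omega> x]] by simp
    finally show "contract x (D (Suc (Suc k)) (D (Suc k) \<omega>)) = contract x 0" by (simp add: fun_eq_iff)
  qed (simp_all add: D_outside)
qed

abbreviation "Z \<equiv> cocycles scl br L"
abbreviation "Bd \<equiv> coboundaries scl br L"

lemma coboundaries_subset: "Bd k \<subseteq> Z k"
  using D_D D_cochain cochains_zero D_zero
  by (auto simp: coboundaries_def cocycles_def split: nat.splits)

lemma coboundaries_smult: "\<omega> \<in> Bd k \<Longrightarrow> (\<lambda>xs. c * \<omega> xs) \<in> Bd k"
proof (cases k)
  case (Suc l)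
  assume "\<omega> \<in> Bd k"
  then obtain \<eta> where "\<eta> \<in> C l" "\<omega> = D l \<eta>" using Suc by (auto simp: coboundaries_def)
  then show ?thesis using Suc D_smult[of l c \<eta>, symmetric] cochains_smult[of \<eta> l c]
    by (auto simp: coboundaries_def)
qed (auto simp: coboundaries_def)

lemma coboundaries_plus: "\<omega> \<in> Bd k \<Longrightarrow> \<eta> \<in> Bd k \<Longrightarrow> \<omega> + \<eta> \<in> Bd k"
proof (cases k)
  case (Suc l)
  assume "\<omega> \<in> Bd k" "\<eta> \<in> Bd k"
  then obtain a b where "a \<in> C l" "\<omega> = D l a" "b \<in> C l" "\<eta> = D l b"
    using Suc by (auto simp: coboundaries_def)
  then show ?thesis using Suc D_plus[of l a b, symmetric] cochains_plus[of a l b]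
    by (auto simp: coboundaries_def)
qed (auto simp: coboundaries_def)

text \<open>
  The Lie algebra acts trivially on its cohomology: on cocycles, Cartan's formula exhibits the Lie
  derivative along \<open>x\<close> as the differential of the contraction by \<open>x\<close>.
\<close>

lemma lie_deriv_cocycle:
  assumes \<omega>: "\<omega> \<in> Z k" and x: "x \<in> L"
  shows "lie_deriv x \<omega> \<in> Z k" "lie_deriv x \<omega> \<in> Bd k"
proof -
  have c: "\<omega> \<in> C k" and d: "D k \<omega> = 0" using \<omega> by (auto simp: cocycles_def)
  show "lie_deriv x \<omega> \<in> Bd k"
  proof (cases k)
    case 0
    then show ?thesis using lie_deriv_cochain_0 c by (simp add: coboundaries_def)
  next
    case (Suc l)
    have "lie_deriv x \<omega> = D l (contract x \<omega>)"
      using contract_D[of \<omega> l x] c x d Suc by (simp add: fun_eq_iff)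
    then show ?thesis using contract_cochain[of \<omega> l x] c x Suc by (simp add: coboundaries_def)
  qed
  then show "lie_deriv x \<omega> \<in> Z k" using coboundaries_subset by blast
qed

lemma cocycles_minus: "\<omega> \<in> Z k \<Longrightarrow> \<eta> \<in> Z k \<Longrightarrow> \<omega> - \<eta> \<in> Z k"
  and cocycles_plus: "\<omega> \<in> Z k \<Longrightarrow> \<eta> \<in> Z k \<Longrightarrow> \<omega> + \<eta> \<in> Z k"
  and cocycles_smult: "\<omega> \<in> Z k \<Longrightarrow> (\<lambda>xs. c * \<omega> xs) \<in> Z k"
  by (auto simp: cocycles_def cochains_minus cochains_plus cochains_smult D_minus D_plus D_smult
      zero_fun_def)

lemma lie_deriv_weight_vectors:
  assumes \<omega>: "\<omega> \<in> C k" and xs: "xs \<in> T k"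
    and eig: "\<And>l. l < k \<Longrightarrow> br h (xs ! l) = scl (- of_nat (m l)) (xs ! l)"
  shows "lie_deriv h \<omega> xs = of_nat (\<Sum>l<k. m l) * \<omega> xs"
proof -
  have "\<omega> (xs[l := br h (xs ! l)]) = - of_nat (m l) * \<omega> xs" if "l < k" for l
  proof -
    have "xs ! l \<in> L" using xs that nth_mem[of l xs] by (auto simp: tuples_def)
    from cochain_scale[OF \<omega> xs that this, of "- of_nat (m l)"] show ?thesis
      by (simp only: eig[OF that] list_update_id)
  qed
  then show ?thesis using xs by (simp add: lie_deriv_def tuples_def sum_negf sum_distrib_right)
qed

text \<open>
  The sign is chosen such that the degrees \<open>m\<close> are natural numbers for the algebras considered
  here, whose ideal \<open>L0\<close> has negative eigenvalues.
\<close>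

definition weight_space :: "'v \<Rightarrow> nat \<Rightarrow> 'v set" where
  "weight_space h m = {x \<in> L. br h x = scl (- of_nat m) x}"

text \<open>
  On a tuple of vectors of degrees \<open>m\<^sub>1, \<dots>, m\<^sub>k\<close> the Lie derivative along \<open>h\<close> is multiplication by
  \<open>s = m\<^sub>1 + \<dots> + m\<^sub>k\<close>, and \<open>0 \<le> s \<le> k * M\<close>. Subtracting \<open>1 / j\<close> times the Lie derivative multiplies
  the component of total degree \<open>s\<close> by \<open>1 - s / j\<close>: it kills the component of total degree \<open>j\<close>,
  keeps the one of total degree zero, and does not change the cohomology class. Doing this for
  \<open>j = 1, \<dots>, k * M\<close> removes all components of positive total degree; the component of total
  degree zero lives on tuples from \<open>B 0\<close>, where the cocycle vanishes by assumption. So the result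
  is zero, and the cocycle is a coboundary.
\<close>

theorem cocycle_vanishing_in_degree_zero:
  assumes h: "h \<in> L" and B: "\<And>m. B m \<subseteq> weight_space h m" and sp: "L \<subseteq> span (\<Union>m\<le>M. B m)"
    and \<omega>: "\<omega> \<in> Z k" and van: "\<And>xs. xs \<in> tuples (B 0) k \<Longrightarrow> \<omega> xs = 0"
  shows "\<omega> \<in> Bd k"
proof -
  \<comment> \<open>the cocycle after the components of total degree \<open>1, \<dots>, j\<close> have been removed\<close>
  define it where "it = rec_nat \<omega> (\<lambda>j \<eta> xs. \<eta> xs - 1 / of_nat (Suc j) * lie_deriv h \<eta> xs)"
  have it_0: "it 0 = \<omega>" by (simp add: it_def)
  have it_Suc: "it (Suc j) = it j - (\<lambda>xs. 1 / of_nat (Suc j) * lie_deriv h (it j) xs)" for j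
    by (simp add: it_def fun_eq_iff)
  have Z: "it j \<in> Z k" for j
  proof (induction j)
    case (Suc j)
    then show ?case unfolding it_Suc
      by (intro cocycles_minus cocycles_smult lie_deriv_cocycle(1) h)
  qed (simp add: it_0 \<omega>)
  have Bd: "\<omega> - it j \<in> Bd k" for j
  proof (induction j)
    case 0
    show ?case using coboundaries_smult[OF lie_deriv_cocycle(2)[OF \<omega> h], of 0]
      by (simp add: it_0 zero_fun_def)
  next
    case (Suc j)
    have "\<omega> - it (Suc j) = (\<omega> - it j) + (\<lambda>xs. 1 / of_nat (Suc j) * lie_deriv h (it j) xs)"
      unfolding it_Suc by simp
    then show ?case
      using coboundaries_plus[OF Suc coboundaries_smult[OF lie_deriv_cocycle(2)[OF Z[of j] h],
            of "1 / of_nat (Suc j)"]] by (simp only:)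
  qed
  have "it (k * M) = 0"
  proof (rule cochain_eq_zero_on_span[OF _ sp])
    show "(\<Union>m\<le>M. B m) \<subseteq> L" using B by (auto simp: weight_space_def)
    show "it (k * M) \<in> C k" using Z by (simp add: cocycles_def)
    fix xs assume xs: "xs \<in> tuples (\<Union>m\<le>M. B m) k"
    then have "\<forall>l. \<exists>m. l < k \<longrightarrow> m \<le> M \<and> xs ! l \<in> B m"
      unfolding tuples_def using nth_mem[of _ xs] by blast
    then obtain m where m: "\<And>l. l < k \<Longrightarrow> m l \<le> M \<and> xs ! l \<in> B (m l)" by metis
    have xsL: "xs \<in> T k" using xs B by (fastforce simp: tuples_def weight_space_def)
    let ?s = "\<Sum>l<k. m l"
    have lie_deriv: "lie_deriv h (it j) xs = of_nat ?s * it j xs" for j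
      by (rule lie_deriv_weight_vectors[OF _ xsL]) (use Z m B in \<open>auto simp: cocycles_def weight_space_def\<close>)
    have step: "it (Suc j) xs = (1 - of_nat ?s / of_nat (Suc j)) * it j xs" for j
      by (simp add: it_Suc lie_deriv field_simps del: of_nat_Suc)
    show "it (k * M) xs = 0"
    proof (cases "?s = 0")
      case True
      then have "xs \<in> tuples (B 0) k"
        using m xs by (fastforce simp: tuples_def in_set_conv_nth)
      then have "\<omega> xs = 0" by (rule van)
      then have "it j xs = 0" for j by (induction j) (simp_all only: it_0 step mult_zero_right)
      then show ?thesis .
    next
      case False
      have z: "it (?s + j) xs = 0" for j
      proof (induction j)
        case 0
        \<comment> \<open>the step number \<open>?s\<close> multiplies by \<open>1 - ?s / ?s\<close>\<close>
        obtain t where "?s = Suc t" using False not0_implies_Suc by blast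
        then show ?case using step[of t] by (simp del: of_nat_Suc)
      next
        case (Suc j)
        then show ?case using step[of "?s + j"] by simp
      qed
      have "?s \<le> k * M" using sum_mono[of "{..<k}" m "\<lambda>_. M"] m by simp
      then show ?thesis using z[of "k * M - ?s"] by simp
    qed
  qed
  then show ?thesis using Bd[of "k * M"] by simp
qed

end

section \<open>Coordinates on alternating forms\<close>

text \<open>
  The exterior product of a linear form and an alternating form: the expansion of a determinant
  along its first row, unrolled so that contraction is an antiderivation by definition
  (\<open>contract_wedge\<close>).
\<close>

fun wedge :: "('v \<Rightarrow> complex) \<Rightarrow> ('v list \<Rightarrow> complex) \<Rightarrow> 'v list \<Rightarrow> complex" where
  "wedge f \<eta> [] = 0"
| "wedge f \<eta> (x # xs) = f x * \<eta> xs - wedge f (contract x \<eta>) xs"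

lemma wedge_plus: "wedge f (\<eta> + \<zeta>) xs = wedge f \<eta> xs + wedge f \<zeta> xs"
proof (induction xs arbitrary: \<eta> \<zeta>)
  case (Cons x xs)
  have "contract x (\<eta> + \<zeta>) = contract x \<eta> + contract x \<zeta>" by (simp add: fun_eq_iff)
  then show ?case by (simp add: Cons.IH algebra_simps del: contract_apply plus_fun_apply)
    (simp add: algebra_simps)
qed simp

lemma wedge_smult: "wedge f (\<lambda>ys. c * \<eta> ys) xs = c * wedge f \<eta> xs"
proof (induction xs arbitrary: \<eta>)
  case (Cons x xs)
  have "contract x (\<lambda>ys. c * \<eta> ys) = (\<lambda>ys. c * contract x \<eta> ys)" by (simp add: fun_eq_iff)
  then show ?case by (simp add: Cons.IH algebra_simps del: contract_apply)
qed simp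

lemma wedge_zero: "wedge f 0 xs = 0"
  using wedge_smult[of f 0 0 xs] by (simp add: zero_fun_def)

primrec coframe_wedge :: "('i \<Rightarrow> 'v \<Rightarrow> complex) \<Rightarrow> 'i list \<Rightarrow> 'v list \<Rightarrow> complex" where
  "coframe_wedge lam [] = (\<lambda>xs. if xs = [] then 1 else 0)"
| "coframe_wedge lam (i # is) = wedge (lam i) (coframe_wedge lam is)"

definition increasing_lists :: "nat \<Rightarrow> 'i::linorder list set" where
  "increasing_lists k = {is. length is = k \<and> sorted_wrt (<) is}"

lemma finite_increasing_lists: "finite (increasing_lists k :: 'i::{finite,linorder} list set)"
  by (rule finite_subset[OF _ finite_lists_length_eq[of UNIV k]]) (auto simp: increasing_lists_def)

context form_space
begin

definition functional :: "('v \<Rightarrow> complex) \<Rightarrow> bool" where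
  "functional f \<longleftrightarrow> (\<forall>x. x \<notin> L \<longrightarrow> f x = 0) \<and>
     (\<forall>x\<in>L. \<forall>y\<in>L. \<forall>c. f (scl c x + y) = c * f x + f y)"

lemma contract_wedge: "contract x (wedge f \<eta>) = (\<lambda>xs. f x * \<eta> xs) - wedge f (contract x \<eta>)"
  by (simp add: fun_eq_iff contract_def)

lemma contract_outside: "\<omega> \<in> C k \<Longrightarrow> x \<notin> L \<Longrightarrow> contract x \<omega> = 0"
  by (auto simp: fun_eq_iff tuples_def intro!: cochain_outside[of \<omega> k])

text \<open>
  Contraction by \<open>x\<close> reduces everything to lower degree; for two equal leading arguments the two
  terms \<open>f x\<close> times the contracted form cancel.
\<close>

lemma wedge_cochain: "functional f \<Longrightarrow> \<eta> \<in> C k \<Longrightarrow> wedge f \<eta> \<in> C (Suc k)"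
proof (induction k arbitrary: \<eta>)
  case 0
  note f = 0(1) and \<eta> = 0(2)
  have i: "contract x (wedge f \<eta>) = (\<lambda>xs. f x * \<eta> xs)" for x
    unfolding contract_wedge contract_cochain_0[OF \<eta>] by (simp add: fun_eq_iff wedge_zero)
  show ?case
  proof (rule cochain_SucI)
    fix x assume "x \<in> L"
    show "contract x (wedge f \<eta>) \<in> C 0" unfolding i by (rule cochains_smult[OF \<eta>])
    show "contract x (contract x (wedge f \<eta>)) = 0"
      unfolding i using cochain_outside_0[OF \<eta>] by (simp add: fun_eq_iff)
  next
    fix x xs assume "x \<notin> L"
    then show "wedge f \<eta> (x # xs) = 0"
      using fun_cong[OF i[of x], of xs] f by (simp add: functional_def)
  next
    fix x y c assume "x \<in> L" "y \<in> L"
    then show "contract (scl c x + y) (wedge f \<eta>) =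
        (\<lambda>xs. c * contract x (wedge f \<eta>) xs) + contract y (wedge f \<eta>)"
      unfolding i using f by (simp add: functional_def fun_eq_iff algebra_simps)
  qed simp
next
  case (Suc k)
  note f = Suc.prems(1) and \<eta> = Suc.prems(2)
  show ?case
  proof (rule cochain_SucI)
    fix x assume x: "x \<in> L"
    show "contract x (wedge f \<eta>) \<in> C (Suc k)" unfolding contract_wedge
      by (intro cochains_minus cochains_smult \<eta> Suc.IH f contract_cochain x)
    have "contract x (contract x (wedge f \<eta>)) =
        (\<lambda>xs. f x * contract x \<eta> xs) - contract x (wedge f (contract x \<eta>))"
      by (simp add: contract_wedge fun_eq_iff)
    also have "\<dots> = 0"
      unfolding contract_wedge[of x f "contract x \<eta>"] contract_contract_same[OF \<eta> x]
      by (simp add: fun_eq_iff wedge_zero)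
    finally show "contract x (contract x (wedge f \<eta>)) = 0" .
  next
    fix x xs assume "x \<notin> L"
    then show "wedge f \<eta> (x # xs) = 0"
      using fun_cong[OF contract_wedge[of x f \<eta>], of xs] f contract_outside[OF \<eta>]
      by (simp add: functional_def wedge_zero)
  next
    fix x y c assume xy: "x \<in> L" "y \<in> L"
    then show "contract (scl c x + y) (wedge f \<eta>) =
        (\<lambda>xs. c * contract x (wedge f \<eta>) xs) + contract y (wedge f \<eta>)"
      unfolding contract_wedge contract_linear[OF \<eta> xy] using f
      by (simp add: functional_def fun_eq_iff algebra_simps wedge_plus wedge_smult del: contract_apply)
  qed simp
qed

end

text \<open>
  Linearly independent vectors \<open>b i\<close> with linear forms \<open>lam i\<close> dual to them. The forms extend the
  coordinates with respect to the \<open>b i\<close> to all of \<open>L\<close>, which may be larger than the span of the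
  \<open>b i\<close>.
\<close>

locale coframe = form_space scl L
  for scl :: "complex \<Rightarrow> 'v::ab_group_add \<Rightarrow> 'v" and L :: "'v set" +
  fixes b :: "'i::{finite,linorder} \<Rightarrow> 'v" and lam :: "'i \<Rightarrow> 'v \<Rightarrow> complex"
  assumes b_in: "b i \<in> L"
    and lam: "functional (lam i)"
    and lam_b: "lam i (b j) = of_bool (i = j)"
begin

lemma coframe_wedge_cochain: "coframe_wedge lam is \<in> C (length is)"
  by (induction "is") (auto intro!: wedge_cochain lam cochain_0I)

lemma contract_coframe_wedge_zero: "(\<And>i. i \<in> set is \<Longrightarrow> lam i x = 0) \<Longrightarrow> contract x (coframe_wedge lam is) = 0"
proof (induction "is")
  case (Cons i js)
  have z: "contract x (coframe_wedge lam js) = 0" by (rule Cons.IH) (use Cons.prems in simp)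
  show ?case unfolding coframe_wedge.simps contract_wedge z using Cons.prems by (simp add: wedge_zero fun_eq_iff)
qed (simp add: fun_eq_iff)

lemma wedge_basis_zero: "i \<notin> set js \<Longrightarrow> wedge (lam i) \<eta> (map b js) = 0"
  by (induction js arbitrary: \<eta>) (simp_all add: lam_b)

text \<open>
  The minors of the identity matrix. In the comparison of the first entries \<open>i\<close> and \<open>j\<close>, the
  smaller of the two occurs nowhere in the other list, since both lists increase; so its row or
  column is zero.
\<close>

lemma coframe_wedge_basis:
  "sorted_wrt (<) is \<Longrightarrow> sorted_wrt (<) js \<Longrightarrow> length is = length js \<Longrightarrow>
     coframe_wedge lam is (map b js) = of_bool (is = js)"
proof (induction "is" arbitrary: js)
  case (Cons i is')
  then obtain j js' where js: "js = j # js'" by (cases js) auto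
  have w: "coframe_wedge lam (i # is') (map b js) =
      lam i (b j) * coframe_wedge lam is' (map b js') - wedge (lam i) (contract (b j) (coframe_wedge lam is')) (map b js')"
    by (simp add: js)
  consider "i = j" | "i < j" | "j < i" by fastforce
  then show ?case
  proof cases
    case 1
    have "contract (b j) (coframe_wedge lam is') = 0"
      by (rule contract_coframe_wedge_zero) (use Cons.prems 1 in \<open>auto simp: lam_b\<close>)
    then show ?thesis using w Cons.IH[of js'] Cons.prems js 1 by (simp add: lam_b wedge_zero)
  next
    case 2
    then have "i \<notin> set js" using Cons.prems js by auto
    then show ?thesis using wedge_basis_zero[of i js] js by auto
  next
    case 3
    have "contract (b j) (coframe_wedge lam is') = 0"
      by (rule contract_coframe_wedge_zero) (use Cons.prems 3 in \<open>auto simp: lam_b\<close>)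
    then show ?thesis using w js 3 by (auto simp: lam_b wedge_zero)
  qed
qed auto

definition coord :: "nat \<Rightarrow> ('v list \<Rightarrow> complex) \<Rightarrow> 'i list \<Rightarrow> complex" where
  "coord k \<omega> = (\<lambda>is. if is \<in> increasing_lists k then \<omega> (map b is) else 0)"

definition form_with_coords :: "nat \<Rightarrow> ('i list \<Rightarrow> complex) \<Rightarrow> 'v list \<Rightarrow> complex" where
  "form_with_coords k f = (\<lambda>xs. \<Sum>is\<in>increasing_lists k. f is * coframe_wedge lam is xs)"

lemma form_with_coords_cochain: "form_with_coords k f \<in> C k"
  unfolding form_with_coords_def
  by (rule cochains_sum, rule cochains_smult) (use coframe_wedge_cochain in \<open>auto simp: increasing_lists_def\<close>)

lemma coord_form_with_coords:
  assumes "\<And>is. is \<notin> increasing_lists k \<Longrightarrow> f is = 0"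
  shows "coord k (form_with_coords k f) = f"
proof
  fix js show "coord k (form_with_coords k f) js = f js"
  proof (cases "js \<in> increasing_lists k")
    case True
    have "form_with_coords k f (map b js) = (\<Sum>is\<in>increasing_lists k. if is = js then f is else 0)"
      unfolding form_with_coords_def by (rule sum.cong) (use True in \<open>auto simp: coframe_wedge_basis increasing_lists_def\<close>)
    then show ?thesis using True by (simp add: coord_def finite_increasing_lists)
  qed (simp add: coord_def assms)
qed

text \<open>
  A tuple of basis vectors either has a repetition or can be sorted into an increasing one.
\<close>

lemma coord_zero_imp:
  assumes \<omega>: "\<omega> \<in> C k" and z: "coord k \<omega> = 0" and xs: "xs \<in> tuples (range b) k"
  shows "\<omega> xs = 0"
proof -
  from xs have "set xs \<subseteq> range b" by (simp add: tuples_def)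
  then obtain js where js: "xs = map b js" by (metis ex_map_conv subsetD rangeE)
  have xsT: "xs \<in> T k" using xs b_in by (auto simp: tuples_def)
  show ?thesis
  proof (cases "distinct js")
    case False
    then obtain i j where "i < j" "j < length js" "js ! i = js ! j"
      unfolding distinct_conv_nth by (metis nat_neq_iff)
    then show ?thesis
      using cochain_alternating[OF \<omega> xsT, of i j] xs js by (auto simp: tuples_def)
  next
    case True
    have "sorted_wrt (<) (sort js)" using True by (simp add: strict_sorted_iff)
    then have "sort js \<in> increasing_lists k" using xs js by (auto simp: tuples_def increasing_lists_def)
    then have "\<omega> (map b (sort js)) = 0" using fun_cong[OF z, of "sort js"] by (simp add: coord_def)
    then show ?thesis
      using cochain_permute_zero[OF \<omega>, of xs "map b (sort js)" "[]"] xsT js by simp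
  qed
qed

lemma form_with_coords_coord:
  assumes sp: "L \<subseteq> span (range b)" and \<omega>: "\<omega> \<in> C k"
  shows "form_with_coords k (coord k \<omega>) = \<omega>"
proof -
  have "form_with_coords k (coord k \<omega>) - \<omega> = 0"
  proof (rule cochain_eq_zero_on_span[OF _ sp])
    show m: "form_with_coords k (coord k \<omega>) - \<omega> \<in> C k" by (intro cochains_minus form_with_coords_cochain \<omega>)
    have "coord k (form_with_coords k (coord k \<omega>)) = coord k \<omega>"
      by (rule coord_form_with_coords) (simp add: coord_def)
    then have "coord k (form_with_coords k (coord k \<omega>) - \<omega>) = 0"
      by (auto simp: coord_def fun_eq_iff split: if_splits)
    then show "(form_with_coords k (coord k \<omega>) - \<omega>) xs = 0" if "xs \<in> tuples (range b) k" for xs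
      using coord_zero_imp[OF m _ that] by blast
  qed (use b_in in auto)
  then show ?thesis by simp
qed

end

section \<open>Isomorphisms of quotient spaces\<close>

text \<open>
  A quotient \<open>Z / B\<close> presented as the image of a linear map to a space of functions. The target is
  a space of functions so that quotients of spaces of different types can be compared.
\<close>

locale coordinatized_quotient = vector_space scl
  for scl :: "complex \<Rightarrow> 'a::ab_group_add \<Rightarrow> 'a" +
  fixes Z B :: "'a set" and \<Phi> :: "'a \<Rightarrow> 'i \<Rightarrow> complex"
  assumes Z: "subspace Z"
    and add: "x \<in> Z \<Longrightarrow> y \<in> Z \<Longrightarrow> \<Phi> (x + y) = \<Phi> x + \<Phi> y"
    and scale: "x \<in> Z \<Longrightarrow> \<Phi> (scl c x) = (\<lambda>i. c * \<Phi> x i)"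
    and B: "B = {x \<in> Z. \<Phi> x = 0}"
begin

definition fibre :: "('i \<Rightarrow> complex) \<Rightarrow> 'a set" where
  "fibre v = {x \<in> Z. \<Phi> x = v}"

lemma quotient_fibres:
  shows "vcarrier (quotient_space scl Z B) = fibre ` \<Phi> ` Z"
    and "u \<in> \<Phi> ` Z \<Longrightarrow> v \<in> \<Phi> ` Z \<Longrightarrow> vadd (quotient_space scl Z B) (fibre u) (fibre v) = fibre (u + v)"
    and "v \<in> \<Phi> ` Z \<Longrightarrow> vscale (quotient_space scl Z B) c (fibre v) = fibre (\<lambda>i. c * v i)"
proof -
  note cl = subspace_add[OF Z] subspace_scale[OF Z] subspace_diff[OF Z]
  have diff: "\<Phi> (x - y) = \<Phi> x - \<Phi> y" if "x \<in> Z" "y \<in> Z" for x y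
    using add[OF cl(3)[OF that] that(2)] by simp
  have split: "\<exists>z. z \<in> Z \<and> \<Phi> z = 0 \<and> y = x + z" if "x \<in> Z" "y \<in> Z" "\<Phi> y = \<Phi> x" for x y
    using cl(3)[OF that(2,1)] diff[OF that(2,1)] that(3) by (intro exI[of _ "y - x"]) simp
  have coset: "x +o B = fibre (\<Phi> x)" if x: "x \<in> Z" for x
    using split[OF x] cl(1)[OF x] add[OF x] by (auto simp: elt_set_plus_def B fibre_def)
  show "vcarrier (quotient_space scl Z B) = fibre ` \<Phi> ` Z"
    using coset by (auto simp: quotient_space_def image_image)
  have plus: "fibre (\<Phi> x) + fibre w = fibre (\<Phi> x + w)" if x: "x \<in> Z" and w: "w \<in> \<Phi> ` Z" for x w
  proof
    show "fibre (\<Phi> x) + fibre w \<subseteq> fibre (\<Phi> x + w)" using cl(1) add by (auto simp: set_plus_def fibre_def)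
    show "fibre (\<Phi> x + w) \<subseteq> fibre (\<Phi> x) + fibre w"
    proof
      fix y assume "y \<in> fibre (\<Phi> x + w)"
      then have "y - x \<in> fibre w" "x \<in> fibre (\<Phi> x)" using cl(3)[OF _ x] diff[OF _ x] x by (auto simp: fibre_def)
      then show "y \<in> fibre (\<Phi> x) + fibre w"
        using set_plus_intro[of x "fibre (\<Phi> x)" "y - x" "fibre w"] by simp
    qed
  qed
  then show "vadd (quotient_space scl Z B) (fibre u) (fibre v) = fibre (u + v)"
    if "u \<in> \<Phi> ` Z" "v \<in> \<Phi> ` Z" using that by (auto simp: quotient_space_def)
  show "vscale (quotient_space scl Z B) c (fibre v) = fibre (\<lambda>i. c * v i)" if v: "v \<in> \<Phi> ` Z"
  proof -
    have s: "scl c ` fibre v \<subseteq> fibre (\<lambda>i. c * v i)" using cl(2) scale by (auto simp: fibre_def)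
    obtain x where x: "x \<in> Z" "\<Phi> x = v" using v by blast
    have "scl c ` fibre v + B = fibre (\<lambda>i. c * v i)"
    proof
      show "scl c ` fibre v + B \<subseteq> fibre (\<lambda>i. c * v i)"
      proof
        fix y assume "y \<in> scl c ` fibre v + B"
        then obtain w z where y: "y = w + z" and w: "w \<in> fibre (\<lambda>i. c * v i)" and z: "z \<in> B"
          using s by (elim set_plus_elim) blast
        have wz: "w \<in> Z" "z \<in> Z" "\<Phi> w = (\<lambda>i. c * v i)" "\<Phi> z = 0"
          using w z by (simp_all add: fibre_def B)
        then show "y \<in> fibre (\<lambda>i. c * v i)"
          using cl(1)[OF wz(1,2)] add[OF wz(1,2)] unfolding y fibre_def by simp
      qed
      show "fibre (\<lambda>i. c * v i) \<subseteq> scl c ` fibre v + B"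
      proof
        fix y assume "y \<in> fibre (\<lambda>i. c * v i)"
        then obtain z where "z \<in> B" "y = scl c x + z"
          using split[OF cl(2)[OF x(1), of c], of y] scale[OF x(1), of c] x by (auto simp: fibre_def B)
        then show "y \<in> scl c ` fibre v + B" using x by (auto simp: fibre_def intro!: set_plus_intro)
      qed
    qed
    then show ?thesis by (simp add: quotient_space_def)
  qed
qed

lemma coord_image_closed:
  shows "u \<in> \<Phi> ` Z \<Longrightarrow> v \<in> \<Phi> ` Z \<Longrightarrow> u + v \<in> \<Phi> ` Z"
    and "v \<in> \<Phi> ` Z \<Longrightarrow> (\<lambda>i. c * v i) \<in> \<Phi> ` Z"
  using add scale subspace_add[OF Z] subspace_scale[OF Z] by (auto simp: image_iff) metis+

end

text \<open>
  Cosets are fibres of the coordinate maps, and the isomorphism matches the fibres over the same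
  point.
\<close>

lemma quotient_spaces_iso:
  fixes \<Phi> :: "'a::ab_group_add \<Rightarrow> 'i \<Rightarrow> complex" and \<Psi> :: "'b::ab_group_add \<Rightarrow> 'i \<Rightarrow> complex"
  assumes "coordinatized_quotient scl Z B \<Phi>" and "coordinatized_quotient scl' Z' B' \<Psi>"
    and im: "\<Phi> ` Z = \<Psi> ` Z'"
  shows "cvec_iso (quotient_space scl Z B) (quotient_space scl' Z' B')"
proof -
  interpret F: coordinatized_quotient scl Z B \<Phi> by fact
  interpret G: coordinatized_quotient scl' Z' B' \<Psi> by fact
  define f where "f U = {y \<in> Z'. \<exists>x\<in>U. \<Psi> y = \<Phi> x}" for U
  have f: "f (F.fibre v) = G.fibre v" if "v \<in> \<Phi> ` Z" for v
    using that by (auto simp: f_def F.fibre_def G.fibre_def)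
  have "bij_betw f (F.fibre ` \<Phi> ` Z) (G.fibre ` \<Phi> ` Z)"
  proof (rule bij_betwI')
    fix U V assume "U \<in> F.fibre ` \<Phi> ` Z" "V \<in> F.fibre ` \<Phi> ` Z"
    then obtain u v where uv: "u \<in> \<Phi> ` Z" "v \<in> \<Phi> ` Z" "U = F.fibre u" "V = F.fibre v" by blast
    then have "G.fibre u = G.fibre v \<Longrightarrow> u = v" unfolding im by (auto simp: G.fibre_def)
    then show "f U = f V \<longleftrightarrow> U = V" using uv f by metis
  qed (use f in \<open>auto intro!: bexI\<close>)
  then show ?thesis
    unfolding cvec_iso_def F.quotient_fibres(1) G.quotient_fibres(1) im[symmetric]
    by (intro exI[of _ f] conjI ballI allI; (elim imageE)?)
      (simp_all add: F.quotient_fibres(2,3) G.quotient_fibres(2,3)[folded im] F.coord_image_closed f)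
qed

section \<open>Exterior powers and alternating forms\<close>

text \<open>
  A form on tuples, extended linearly to the free vector space on tuples.
\<close>

definition pairing :: "('v list \<Rightarrow> complex) \<Rightarrow> ('v list \<Rightarrow>\<^sub>0 complex) \<Rightarrow> complex" where
  "pairing \<omega> F = (\<Sum>xs\<in>Poly_Mapping.keys F. Poly_Mapping.lookup F xs * \<omega> xs)"

lemma pairing_superset:
  assumes "finite A" "Poly_Mapping.keys F \<subseteq> A"
  shows "pairing \<omega> F = (\<Sum>xs\<in>A. Poly_Mapping.lookup F xs * \<omega> xs)"
  unfolding pairing_def by (rule sum.mono_neutral_left[OF assms]) (auto simp: in_keys_iff)

lemma pairing_plus: "pairing \<omega> (F + G) = pairing \<omega> F + pairing \<omega> G"
proof -
  let ?A = "Poly_Mapping.keys F \<union> Poly_Mapping.keys G"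
  have "Poly_Mapping.keys (F + G) \<subseteq> ?A" by (rule Poly_Mapping.keys_add)
  then show ?thesis
    by (simp add: pairing_superset[of ?A] lookup_add algebra_simps sum.distrib)
qed

lemma pairing_scale: "pairing \<omega> (pm_scale c F) = c * pairing \<omega> F"
proof -
  have "Poly_Mapping.keys (pm_scale c F) \<subseteq> Poly_Mapping.keys F" by (auto simp: in_keys_iff)
  then show ?thesis
    by (simp add: pairing_superset[of "Poly_Mapping.keys F"] sum_distrib_left mult.assoc)
qed

lemma pairing_single: "pairing \<omega> (Poly_Mapping.single xs c) = c * \<omega> xs"
  by (cases "c = 0") (simp_all add: pairing_def)

lemma pairing_minus: "pairing \<omega> (F - G) = pairing \<omega> F - pairing \<omega> G"
  using pairing_plus[of \<omega> "F - G" G] by simp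

lemma pairing_eq_linear:
  assumes "Vector_Spaces.linear pm_scale (*) g"
  shows "g F = pairing (\<lambda>xs. g (Poly_Mapping.single xs 1)) F"
proof -
  interpret g: Vector_Spaces.linear pm_scale "(*)" g by (rule assms)
  have "F = (\<Sum>xs\<in>Poly_Mapping.keys F. pm_scale (Poly_Mapping.lookup F xs) (Poly_Mapping.single xs 1))"
  proof (rule poly_mapping_eqI)
    fix k show "Poly_Mapping.lookup F k = Poly_Mapping.lookup (\<Sum>xs\<in>Poly_Mapping.keys F.
        pm_scale (Poly_Mapping.lookup F xs) (Poly_Mapping.single xs 1)) k"
      by (simp add: lookup_sum lookup_single when_def in_keys_iff if_distrib sum.delta' cong: if_cong)
  qed
  then have "g F = g (\<Sum>xs\<in>Poly_Mapping.keys F. pm_scale (Poly_Mapping.lookup F xs) (Poly_Mapping.single xs 1))"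
    by (rule arg_cong)
  then show ?thesis by (simp add: g.sum g.scale pairing_def)
qed

context form_space
begin

lemma pairing_ext_relations:
  assumes \<omega>: "\<omega> \<in> C k" and F: "F \<in> pm.span (ext_relations scl L k)"
  shows "pairing \<omega> F = 0"
  using F
proof (induction rule: pm.span_induct_alt)
  case base
  show ?case by (simp add: pairing_def)
next
  case (step c F G)
  have "pairing \<omega> F = 0"
    using step(1) cochain_linear[OF \<omega>] cochain_alternating[OF \<omega>]
    by (auto simp: ext_relations_def pairing_minus pairing_scale pairing_single)
  then show ?case using step(2) by (simp add: pairing_plus pairing_scale)
qed

text \<open>
  The alternating forms on \<open>L\<close> are the linear functionals on the free vector space on tuples which
  vanish on the relations. So if \<open>F\<close> is not a combination of relations, a functional which
  vanishes on the relations but not at \<open>F\<close> is a form which detects \<open>F\<close>.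
\<close>

lemma in_ext_relations_iff:
  assumes F: "Poly_Mapping.keys F \<subseteq> T k"
  shows "F \<in> pm.span (ext_relations scl L k) \<longleftrightarrow> (\<forall>\<omega>\<in>C k. pairing \<omega> F = 0)"
proof (rule iffI)
  let ?R = "ext_relations scl L k"
  assume van: "\<forall>\<omega>\<in>C k. pairing \<omega> F = 0"
  show "F \<in> pm.span ?R"
  proof (rule ccontr)
    assume nF: "F \<notin> pm.span ?R"
    obtain B where B: "B \<subseteq> ?R" "pm.independent B" "?R \<subseteq> pm.span B"
      by (rule pm.maximal_independent_subset)
    have spB: "pm.span B = pm.span ?R"
      using B(1,3) by (metis pm.span_mono pm.span_span subset_antisym)
    interpret vsp: vector_space_pair pm_scale "(*) :: complex \<Rightarrow> complex \<Rightarrow> complex"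
      by (intro vector_space_pair.intro pm.vector_space_axioms) (unfold_locales, auto simp: algebra_simps)
    have "pm.independent (insert F B)" using B(2) nF spB by (simp add: pm.independent_insert)
    from vsp.linear_independent_extend[OF this, of "\<lambda>x. if x = F then 1 else 0"]
    obtain g where g: "Vector_Spaces.linear pm_scale (*) g"
      and gB: "\<forall>x\<in>insert F B. g x = (if x = F then 1 else 0)" by blast
    interpret g: Vector_Spaces.linear pm_scale "(*)" g by (rule g)
    have gR: "g x = 0" if "x \<in> ?R" for x
    proof -
      have "x \<in> pm.span B" using that B(3) by blast
      then show ?thesis
      proof (induction rule: pm.span_induct_alt)
        case (step c x y)
        have "x \<noteq> F" using step(1) nF spB pm.span_base by blast
        then show ?case using step gB by (simp add: g.add g.scale)
      qed (rule g.zero)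
    qed
    define \<omega> where "\<omega> xs = (if xs \<in> T k then g (Poly_Mapping.single xs 1) else 0)" for xs
    have "\<omega> \<in> C k" unfolding cochains_def
    proof (intro CollectI conjI allI ballI impI)
      fix xs i x y c assume a: "xs \<in> T k" "i < k" "x \<in> L" "y \<in> L"
      then have T: "xs[i := z] \<in> T k" if "z \<in> L" for z
        using that set_update_subset_insert[of xs i z] by (auto simp: tuples_def)
      have "g (Poly_Mapping.single (xs[i := scl c x + y]) 1
        - pm_scale c (Poly_Mapping.single (xs[i := x]) 1) - Poly_Mapping.single (xs[i := y]) 1) = 0"
        by (rule gR) (use a in \<open>auto simp: ext_relations_def\<close>)
      then show "\<omega> (xs[i := scl c x + y]) = c * \<omega> (xs[i := x]) + \<omega> (xs[i := y])"
        using T L_add L_scale a by (simp add: \<omega>_def g.diff g.scale) (simp only: diff_eq_eq add.commute)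
    next
      fix xs i j assume "xs \<in> T k" "i < j \<and> j < k \<and> xs ! i = xs ! j"
      then show "\<omega> xs = 0" unfolding \<omega>_def by (auto intro!: gR simp: ext_relations_def)
    qed (simp add: \<omega>_def)
    then have "pairing \<omega> F = 0" using van by blast
    moreover have "pairing \<omega> F = g F"
      unfolding pairing_eq_linear[OF g, of F] unfolding pairing_def
      by (rule sum.cong) (use F in \<open>auto simp: \<omega>_def\<close>)
    ultimately show False using gB by simp
  qed
qed (use pairing_ext_relations in blast)

end

context coframe
begin

definition ext_coord :: "nat \<Rightarrow> ('v list \<Rightarrow>\<^sub>0 complex) \<Rightarrow> 'i list \<Rightarrow> complex" where
  "ext_coord k F = (\<lambda>is. if is \<in> increasing_lists k then pairing (coframe_wedge lam is) F else 0)"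

lemma pairing_form_with_coords: "pairing (form_with_coords k f) F = (\<Sum>is\<in>increasing_lists k. f is * ext_coord k F is)"
proof -
  have "pairing (form_with_coords k f) F = (\<Sum>is\<in>increasing_lists k. f is * pairing (coframe_wedge lam is) F)"
    unfolding pairing_def form_with_coords_def sum_distrib_left
    by (subst sum.swap) (simp add: mult_ac)
  then show ?thesis by (simp add: ext_coord_def)
qed

text \<open>
  The determinants \<open>coframe_wedge lam is\<close> form a basis of the alternating forms, so pairing with
  these alone decides membership in the span of the relations.
\<close>

lemma ext_coord_kernel:
  assumes sp: "L \<subseteq> span (range b)" and F: "Poly_Mapping.keys F \<subseteq> T k"
  shows "F \<in> pm.span (ext_relations scl L k) \<longleftrightarrow> ext_coord k F = 0"
proof -
  have "ext_coord k F = 0" if "\<forall>\<omega>\<in>C k. pairing \<omega> F = 0"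
    using that coframe_wedge_cochain by (auto simp: ext_coord_def fun_eq_iff increasing_lists_def)
  moreover have "pairing \<omega> F = 0" if "ext_coord k F = 0" "\<omega> \<in> C k" for \<omega>
    using pairing_form_with_coords[of k "coord k \<omega>" F] form_with_coords_coord[OF sp that(2)] that(1) by simp
  ultimately show ?thesis unfolding in_ext_relations_iff[OF F] by blast
qed

lemma ext_coord_image:
  "ext_coord k ` {F. Poly_Mapping.keys F \<subseteq> T k} = {f. \<forall>is. is \<notin> increasing_lists k \<longrightarrow> f is = 0}"
proof (intro equalityI subsetI)
  fix f :: "'i list \<Rightarrow> complex" assume f: "f \<in> {f. \<forall>is. is \<notin> increasing_lists k \<longrightarrow> f is = 0}"
  define F where "F = (\<Sum>js\<in>increasing_lists k. Poly_Mapping.single (map b js) (f js))"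
  have "Poly_Mapping.keys F \<subseteq> (\<Union>js\<in>increasing_lists k. Poly_Mapping.keys (Poly_Mapping.single (map b js) (f js)))"
    unfolding F_def by (rule Poly_Mapping.keys_sum)
  also have "\<dots> \<subseteq> T k" using b_in by (auto simp: tuples_def increasing_lists_def split: if_splits)
  finally have "Poly_Mapping.keys F \<subseteq> T k" .
  moreover have "ext_coord k F = f"
  proof
    fix js
    have sum: "pairing \<omega> (sum G J) = (\<Sum>j\<in>J. pairing \<omega> (G j))"
      if "finite J" for \<omega> J and G :: "'i list \<Rightarrow> 'v list \<Rightarrow>\<^sub>0 complex"
      using that by (induction J rule: finite_induct) (simp add: pairing_def, simp add: pairing_plus)
    show "ext_coord k F js = f js"
    proof (cases "js \<in> increasing_lists k")
      case True
      have "pairing (coframe_wedge lam js) F = (\<Sum>is\<in>increasing_lists k. f is * coframe_wedge lam js (map b is))"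
        by (simp add: F_def pairing_single sum[OF finite_increasing_lists])
      also have "\<dots> = (\<Sum>is\<in>increasing_lists k. if is = js then f is else 0)"
        by (rule sum.cong) (use True in \<open>auto simp: coframe_wedge_basis increasing_lists_def\<close>)
      finally show ?thesis using True by (simp add: ext_coord_def finite_increasing_lists)
    qed (use f in \<open>simp add: ext_coord_def\<close>)
  qed
  ultimately show "f \<in> ext_coord k ` {F. Poly_Mapping.keys F \<subseteq> T k}" by blast
next
  fix f assume "f \<in> ext_coord k ` {F. Poly_Mapping.keys F \<subseteq> T k}"
  then show "f \<in> {f. \<forall>is. is \<notin> increasing_lists k \<longrightarrow> f is = 0}" by (elim imageE) (simp add: ext_coord_def)
qed

end

section \<open>Cohomology of a graded Lie algebra with abelian part of degree zero\<close>

text \<open>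
  The \<open>b i\<close> span an abelian subalgebra, and the dual forms vanish on all brackets, which makes
  them and their exterior products cocycles.
\<close>

locale lie_coframe = lie_algebra scl L br + coframe scl L b lam
  for scl :: "complex \<Rightarrow> 'v::ab_group_add \<Rightarrow> 'v" and L :: "'v set" and br
    and b :: "'i::{finite,linorder} \<Rightarrow> 'v" and lam :: "'i \<Rightarrow> 'v \<Rightarrow> complex" +
  assumes b_commute: "br (b i) (b j) = 0"
    and lam_br: "x \<in> L \<Longrightarrow> y \<in> L \<Longrightarrow> lam i (br x y) = 0"
begin

lemma form_with_coords_cocycle: "form_with_coords k f \<in> Z k"
proof -
  have z: "form_with_coords k f (br x y # ys) = 0" if "x \<in> L" "y \<in> L" for x y ys
  proof -
    have "coframe_wedge lam is (br x y # ys) = 0" for "is"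
      using fun_cong[OF contract_coframe_wedge_zero[of "is" "br x y"], of ys] lam_br[OF that] by simp
    then show ?thesis by (simp add: form_with_coords_def)
  qed
  have "D k (form_with_coords k f) xs = 0" for xs
  proof (cases "xs \<in> T (Suc k)")
    case True
    then have "xs ! i \<in> L" if "i \<le> k" for i using that nth_mem[of i xs] by (auto simp: tuples_def)
    then show ?thesis by (auto simp: ce_diff_def z intro!: sum.neutral)
  qed (rule D_outside)
  then show ?thesis using form_with_coords_cochain by (simp add: cocycles_def fun_eq_iff)
qed

lemma coord_image: "coord k ` Z k = {f. \<forall>is. is \<notin> increasing_lists k \<longrightarrow> f is = 0}"
proof (intro equalityI subsetI)
  fix f :: "'i list \<Rightarrow> complex" assume "f \<in> {f. \<forall>is. is \<notin> increasing_lists k \<longrightarrow> f is = 0}"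
  then have "coord k (form_with_coords k f) = f" by (intro coord_form_with_coords) simp
  then show "f \<in> coord k ` Z k" using form_with_coords_cocycle by (metis imageI)
next
  fix f assume "f \<in> coord k ` Z k"
  then show "f \<in> {f. \<forall>is. is \<notin> increasing_lists k \<longrightarrow> f is = 0}" by (elim imageE) (simp add: coord_def)
qed

lemma coord_coboundary:
  assumes "\<omega> \<in> Bd k"
  shows "coord k \<omega> = 0"
proof (cases k)
  case (Suc l)
  then obtain \<eta> where \<eta>: "\<eta> \<in> C l" "\<omega> = D l \<eta>" using assms by (auto simp: coboundaries_def)
  have z: "\<eta> (0 # ys) = 0" for ys
    using \<eta>(1) contract_zero[of \<eta>] cochain_outside_0[of \<eta>]
    by (cases l) (simp, metis contract_apply zero_fun_apply)
  have "\<omega> (map b is) = 0" if "is \<in> increasing_lists k" for "is"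
    using that Suc by (auto simp: \<eta>(2) ce_diff_def increasing_lists_def b_commute z intro!: sum.neutral)
  then show ?thesis by (auto simp: coord_def)
qed (use assms in \<open>auto simp: coboundaries_def coord_def\<close>)

text \<open>
  Both sides are coordinatized by the values at increasing tuples of basis vectors. For the
  cohomology, the kernel of the coordinate map on cocycles is the space of coboundaries:
  coordinates zero means vanishing on tuples from the part of degree zero, and then
  \<open>cocycle_vanishing_in_degree_zero\<close> applies. For the exterior power of the part of degree zero the
  kernel is given by \<open>ext_coord_kernel\<close>.
\<close>

theorem cohomology_iso_ext_power:
  assumes h: "h \<in> L" and B: "\<And>m. B m \<subseteq> weight_space h m" and sp: "L \<subseteq> span (\<Union>m\<le>M. B m)"
    and B0: "B 0 = range b"
    and V: "subspace V" "range b \<subseteq> V" "V \<subseteq> L" "V \<subseteq> span (range b)"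
  shows "graded_iso (ce_cohomology scl br L) (ext_power scl V)"
  unfolding graded_iso_def ce_cohomology_def ext_power_def
proof
  fix k
  define lam' where "lam' i x = (if x \<in> V then lam i x else 0)" for i x
  interpret V: coframe scl V b lam'
  proof
    show "subspace V" by (rule V)
    then interpret V: form_space scl V by unfold_locales
    show "b i \<in> V" for i using V by blast
    then show "lam' i (b j) = of_bool (i = j)" for i j by (simp add: lam'_def lam_b)
    show "V.functional (lam' i)" for i
      using lam[of i] V(3) V.L_add V.L_scale
      by (auto simp: V.functional_def functional_def lam'_def subset_iff)
  qed
  have vs: "vector_space (\<lambda>c (\<omega>::'v list \<Rightarrow> complex) xs. c * \<omega> xs)"
    by unfold_locales (auto simp: fun_eq_iff algebra_simps)
  have "coordinatized_quotient (\<lambda>c \<omega> xs. c * \<omega> xs) (Z k) (Bd k) (coord k)"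
  proof (intro coordinatized_quotient.intro coordinatized_quotient_axioms.intro vs)
    interpret vf: vector_space "\<lambda>c (\<omega>::'v list \<Rightarrow> complex) xs. c * \<omega> xs" by (rule vs)
    have "0 \<in> Z k" using cochains_zero D_zero by (simp add: cocycles_def)
    then show "vf.subspace (Z k)"
      by (intro vf.subspaceI cocycles_plus cocycles_smult)
    show "coord k (x + y) = coord k x + coord k y" for x y by (auto simp: coord_def)
    show "coord k (\<lambda>xs. c * x xs) = (\<lambda>i. c * coord k x i)" for c x by (auto simp: coord_def)
    show "Bd k = {x \<in> Z k. coord k x = 0}"
    proof (intro equalityI subsetI CollectI conjI)
      fix x assume "x \<in> {x \<in> Z k. coord k x = 0}"
      then have x: "x \<in> Z k" "coord k x = 0" by auto
      then have "x \<in> C k" by (simp add: cocycles_def)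
      from coord_zero_imp[OF this x(2)] show "x \<in> Bd k"
        by (intro cocycle_vanishing_in_degree_zero[OF h B sp x(1)]) (simp add: B0)
    qed (use coord_coboundary coboundaries_subset in blast)+
  qed
  moreover have "coordinatized_quotient pm_scale {F. Poly_Mapping.keys F \<subseteq> V.T k}
        (pm.span (ext_relations scl V k)) (V.ext_coord k)"
  proof (intro coordinatized_quotient.intro coordinatized_quotient_axioms.intro pm.vector_space_axioms)
    have "Poly_Mapping.keys (x + y) \<subseteq> Poly_Mapping.keys x \<union> Poly_Mapping.keys y" for x y :: "'v list \<Rightarrow>\<^sub>0 complex"
      by (rule Poly_Mapping.keys_add)
    moreover have "Poly_Mapping.keys (pm_scale c x) \<subseteq> Poly_Mapping.keys x" for c and x :: "'v list \<Rightarrow>\<^sub>0 complex"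
      by (auto simp: in_keys_iff)
    ultimately show sub: "pm.subspace {F. Poly_Mapping.keys F \<subseteq> V.T k}"
      by (intro pm.subspaceI) (simp, blast+)
    show "V.ext_coord k (x + y) = V.ext_coord k x + V.ext_coord k y" for x y
      by (auto simp: V.ext_coord_def pairing_plus)
    show "V.ext_coord k (pm_scale c x) = (\<lambda>i. c * V.ext_coord k x i)" for c x
      by (auto simp: V.ext_coord_def pairing_scale)
    have "Poly_Mapping.keys F \<subseteq> V.T k" if "F \<in> pm.span (ext_relations scl V k)" for F
    proof -
      have T: "xs[i := z] \<in> V.T k" if "xs \<in> V.T k" "z \<in> V" for xs i z
        using that set_update_subset_insert[of xs i z] by (auto simp: tuples_def)
      have "ext_relations scl V k \<subseteq> {F. Poly_Mapping.keys F \<subseteq> V.T k}"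
        using V.L_add V.L_scale
        by (auto simp: ext_relations_def in_keys_iff lookup_minus lookup_single when_def T
            split: if_splits)
      then show ?thesis
        using pm.span_minimal sub that by blast
    qed
    then show "pm.span (ext_relations scl V k) =
        {x \<in> {F. Poly_Mapping.keys F \<subseteq> V.T k}. V.ext_coord k x = 0}"
      using V.ext_coord_kernel[OF V(4)] by blast
  qed
  moreover have "coord k ` Z k = V.ext_coord k ` {F. Poly_Mapping.keys F \<subseteq> V.T k}"
    unfolding coord_image V.ext_coord_image ..
  ultimately show "cvec_iso (quotient_space (\<lambda>c \<omega> xs. c * \<omega> xs) (Z k) (Bd k))
      (quotient_space pm_scale {F. Poly_Mapping.keys F \<subseteq> V.T k}
        (pm.span (ext_relations scl V k)))"
    by (rule quotient_spaces_iso)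
qed

end

section \<open>Derivations of the polynomial ring\<close>

lemma pm_scale_conv_mult: "pm_scale c p = Poly_Mapping.single 0 c * p"
  by (simp add: pm_scale_def mult_map_scale_conv_mult)

lemma lookup_partial:
  "Poly_Mapping.lookup (partial i p) m =
     (of_nat (Poly_Mapping.lookup m i) + 1) * Poly_Mapping.lookup p (m + Poly_Mapping.single i 1)"
proof -
  let ?e = "Poly_Mapping.single i (1::nat)"
  let ?g = "\<lambda>k. if k = m + ?e then of_nat (Poly_Mapping.lookup k i) * Poly_Mapping.lookup p k else 0"
  have "Poly_Mapping.lookup (partial i p) m = (\<Sum>k\<in>Poly_Mapping.keys p. ?g k)"
    unfolding partial_def lookup_sum
  proof (rule sum.cong)
    fix k assume "k \<in> Poly_Mapping.keys p"
    have "k - ?e = m \<longleftrightarrow> k = m + ?e" if "Poly_Mapping.lookup k i \<noteq> 0"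
    proof
      assume "k - ?e = m"
      then show "k = m + ?e"
        using that by (intro poly_mapping_eqI) (auto simp: lookup_add lookup_minus lookup_single when_def)
    qed (simp add: poly_mapping_eq_iff fun_eq_iff lookup_add lookup_minus)
    then show "Poly_Mapping.lookup (Poly_Mapping.single (k - ?e)
        (of_nat (Poly_Mapping.lookup k i) * Poly_Mapping.lookup p k)) m = ?g k"
      by (cases "Poly_Mapping.lookup k i = 0") (auto simp: lookup_single when_def)
  qed simp
  also have "\<dots> = of_nat (Poly_Mapping.lookup (m + ?e) i) * Poly_Mapping.lookup p (m + ?e)"
    by (simp add: in_keys_iff)
  finally show ?thesis by (simp add: lookup_add algebra_simps)
qed

lemma partial_plus: "partial i (p + q) = partial i p + partial i q"
  by (rule poly_mapping_eqI) (simp add: lookup_partial lookup_add algebra_simps)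

lemma partial_scale: "partial i (pm_scale c p) = pm_scale c (partial i p)"
  by (rule poly_mapping_eqI) (simp add: lookup_partial algebra_simps)

lemma partial_single:
  "partial i (Poly_Mapping.single m c) =
     Poly_Mapping.single (m - Poly_Mapping.single i 1) (of_nat (Poly_Mapping.lookup m i) * c)"
  by (cases "c = 0") (simp_all add: partial_def)

lemma additive_eq_on_monomials:
  fixes A B :: "('a \<Rightarrow>\<^sub>0 'b::comm_monoid_add) \<Rightarrow> 'c::ab_group_add"
  assumes "\<And>p q. A (p + q) = A p + A q" "\<And>p q. B (p + q) = B p + B q"
    and "\<And>m c. A (Poly_Mapping.single m c) = B (Poly_Mapping.single m c)"
  shows "A p = B p"
proof -
  have "A 0 = 0" "B 0 = 0" using assms(1)[of 0 0] assms(2)[of 0 0] by simp_all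
  then have *: "A (\<Sum>m\<in>I. Poly_Mapping.single m (f m)) = B (\<Sum>m\<in>I. Poly_Mapping.single m (f m))" for I f
    by (induction I rule: infinite_finite_induct) (simp_all add: assms)
  have "p = (\<Sum>m\<in>Poly_Mapping.keys p. Poly_Mapping.single m (Poly_Mapping.lookup p m))"
    by (rule poly_mapping_eqI)
      (simp add: lookup_sum lookup_single when_def in_keys_iff if_distrib cong: if_cong)
  then show ?thesis using *[of "Poly_Mapping.lookup p" "Poly_Mapping.keys p"] by simp
qed

lemma partial_single_mult:
  "partial i (Poly_Mapping.single m c * Poly_Mapping.single n e) =
     partial i (Poly_Mapping.single m c) * Poly_Mapping.single n e
     + Poly_Mapping.single m c * partial i (Poly_Mapping.single n e)"
proof -
  let ?e = "Poly_Mapping.single i (1::nat)"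
  have a: "m - ?e + n = m + n - ?e" if "Poly_Mapping.lookup m i \<noteq> 0" for m n :: "'a \<Rightarrow>\<^sub>0 nat"
    using that by (intro poly_mapping_eqI) (auto simp: lookup_add lookup_minus lookup_single when_def)
  have "Poly_Mapping.single (m - ?e + n) (of_nat (Poly_Mapping.lookup m i) * c * e) =
      Poly_Mapping.single (m + n - ?e) (of_nat (Poly_Mapping.lookup m i) * c * e)"
    using a[of m n] by (cases "Poly_Mapping.lookup m i = 0") simp_all
  moreover have "Poly_Mapping.single (m + (n - ?e)) (c * (of_nat (Poly_Mapping.lookup n i) * e)) =
      Poly_Mapping.single (m + n - ?e) (c * (of_nat (Poly_Mapping.lookup n i) * e))"
    using a[of n m] by (cases "Poly_Mapping.lookup n i = 0") (simp_all add: add.commute)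
  ultimately show ?thesis
    by (simp add: partial_single mult_single lookup_add single_add[symmetric] algebra_simps)
qed

lemma partial_mult: "partial i (p * q) = partial i p * q + p * partial i q"
proof (rule additive_eq_on_monomials[of "\<lambda>p. partial i (p * q)"])
  fix m :: "'a \<Rightarrow>\<^sub>0 nat" and c :: complex
  show "partial i (Poly_Mapping.single m c * q) =
      partial i (Poly_Mapping.single m c) * q + Poly_Mapping.single m c * partial i q"
    by (rule additive_eq_on_monomials[of "\<lambda>q. partial i (Poly_Mapping.single m c * q)"])
      (simp_all add: partial_single_mult partial_plus algebra_simps)
qed (simp_all add: partial_plus algebra_simps)

definition derivation :: "('n mpoly \<Rightarrow> 'n mpoly) \<Rightarrow> bool" where
  "derivation A \<longleftrightarrow> (\<forall>p q. A (p + q) = A p + A q) \<and> (\<forall>c p. A (pm_scale c p) = pm_scale c (A p)) \<and>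
     (\<forall>p q. A (p * q) = A p * q + p * A q)"

lemma derivation_add: "derivation A \<Longrightarrow> A (p + q) = A p + A q"
  and derivation_scale: "derivation A \<Longrightarrow> A (pm_scale c p) = pm_scale c (A p)"
  and derivation_mult: "derivation A \<Longrightarrow> A (p * q) = A p * q + p * A q"
  by (simp_all add: derivation_def)

lemma derivation_0: "derivation A \<Longrightarrow> A 0 = 0"
  using derivation_add[of A 0 0] by simp

lemma derivation_diff: "derivation A \<Longrightarrow> A (p - q) = A p - A q"
  using derivation_add[of A "p - q" q] by simp

lemma derivation_1: "derivation A \<Longrightarrow> A 1 = 0"
  using derivation_mult[of A 1 1] by simp

lemma derivation_partial: "derivation (partial i)"
  by (simp add: derivation_def partial_plus partial_scale partial_mult)

lemma pm_scale_mult: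
  fixes p q :: "'n mpoly"
  shows "pm_scale c p * q = pm_scale c (p * q)" "p * pm_scale c q = pm_scale c (p * q)"
  by (simp_all add: pm_scale_conv_mult mult_ac)

lemma derivation_mult_left: "derivation A \<Longrightarrow> derivation (\<lambda>p. r * A p)"
  by (simp add: derivation_def algebra_simps pm_scale_mult)

lemma derivation_zero: "derivation 0"
  by (simp add: derivation_def)

lemma derivation_plus: "derivation A \<Longrightarrow> derivation B \<Longrightarrow> derivation (A + B)"
  by (simp add: derivation_def algebra_simps pm.scale_right_distrib)

lemma derivation_op_scale: "derivation A \<Longrightarrow> derivation (op_scale c A)"
  by (simp add: derivation_def op_scale_def pm.scale_right_distrib pm_scale_mult mult.commute)

lemma commutator_apply: "commutator A B p = A (B p) - B (A p)"
  by (simp add: commutator_def)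

lemma derivation_commutator:
  assumes "derivation A" "derivation B"
  shows "derivation (commutator A B)"
  unfolding derivation_def commutator_apply
  by (simp add: derivation_add[OF assms(1)] derivation_add[OF assms(2)]
      derivation_scale[OF assms(1)] derivation_scale[OF assms(2)]
      derivation_mult[OF assms(1)] derivation_mult[OF assms(2)] algebra_simps pm.scale_right_diff_distrib)

lemma Var_times_single: "Var i * Poly_Mapping.single m c = Poly_Mapping.single (Poly_Mapping.single i 1 + m) c"
  by (simp add: Var_def mult_single)

text \<open>
  Monomials are products of variables, so by the product rule a derivation is determined by its
  values at the variables. This replaces computations in the Weyl algebra by evaluations at
  variables.
\<close>

lemma derivation_eqI:
  fixes A B :: "'n::finite mpoly \<Rightarrow> 'n mpoly"
  assumes A: "derivation A" and B: "derivation B" and AB: "\<And>i. A (Var i) = B (Var i)"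
  shows "A = B"
proof
  have mon: "A (Poly_Mapping.single m 1) = B (Poly_Mapping.single m 1)" for m
  proof (induction "\<Sum>i\<in>UNIV. Poly_Mapping.lookup m i" arbitrary: m)
    case 0
    then have "m = 0" by (simp add: poly_mapping_eq_iff fun_eq_iff)
    then show ?case using derivation_1[OF A] derivation_1[OF B] by simp
  next
    case (Suc N)
    then obtain i where i: "Poly_Mapping.lookup m i \<noteq> 0"
      by (metis (no_types, lifting) nat.distinct(1) sum.neutral)
    define n where "n = m - Poly_Mapping.single i 1"
    have m: "m = Poly_Mapping.single i 1 + n"
      unfolding n_def using i
      by (intro poly_mapping_eqI) (auto simp: lookup_add lookup_minus lookup_single when_def)
    have "(\<Sum>j\<in>UNIV. Poly_Mapping.lookup m j) = (\<Sum>j\<in>UNIV. if i = j then 1 else 0) + (\<Sum>j\<in>UNIV. Poly_Mapping.lookup n j)"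
      unfolding m lookup_add sum.distrib by (simp add: lookup_single when_def)
    then have "N = (\<Sum>j\<in>UNIV. Poly_Mapping.lookup n j)" using Suc(2) by simp
    from Suc(1)[OF this] show ?case
      unfolding m Var_times_single[symmetric] derivation_mult[OF A] derivation_mult[OF B] AB by simp
  qed
  fix p show "A p = B p"
  proof (rule additive_eq_on_monomials[of A B])
    fix m :: "'n \<Rightarrow>\<^sub>0 nat" and c :: complex
    have "Poly_Mapping.single m c = pm_scale c (Poly_Mapping.single m 1)"
      by (rule poly_mapping_eqI) (simp add: lookup_single when_def)
    then show "A (Poly_Mapping.single m c) = B (Poly_Mapping.single m c)"
      by (simp add: derivation_scale[OF A] derivation_scale[OF B] mon)
  qed (simp_all add: derivation_add A B)
qed

text \<open>
  The diagonal vector field with eigenvalue \<open>w i\<close> at \<open>x\<^sub>i\<close>; these fields make up the Cartan part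
  (\<open>cartan_eq_range_torus\<close>).
\<close>

definition torus :: "('n::finite \<Rightarrow> complex) \<Rightarrow> 'n mpoly \<Rightarrow> 'n mpoly" where
  "torus w = (\<lambda>p. \<Sum>i\<in>UNIV. pm_scale (w i) (Var i * partial i p))"

abbreviation wt :: "('n::finite \<Rightarrow> complex) \<Rightarrow> ('n \<Rightarrow>\<^sub>0 nat) \<Rightarrow> complex" where
  "wt w m \<equiv> (\<Sum>i\<in>UNIV. w i * of_nat (Poly_Mapping.lookup m i))"

lemma lookup_Var_partial:
  "Poly_Mapping.lookup (Var i * partial i p) m = of_nat (Poly_Mapping.lookup m i) * Poly_Mapping.lookup p m"
proof (rule additive_eq_on_monomials[of "\<lambda>p. Poly_Mapping.lookup (Var i * partial i p) m"])
  fix n :: "'a \<Rightarrow>\<^sub>0 nat" and c :: complex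
  let ?e = "Poly_Mapping.single i (1::nat)"
  have "?e + (n - ?e) = n" if "Poly_Mapping.lookup n i \<noteq> 0"
    using that by (intro poly_mapping_eqI) (auto simp: lookup_add lookup_minus lookup_single when_def)
  then show "Poly_Mapping.lookup (Var i * partial i (Poly_Mapping.single n c)) m =
      of_nat (Poly_Mapping.lookup m i) * Poly_Mapping.lookup (Poly_Mapping.single n c) m"
    by (cases "Poly_Mapping.lookup n i = 0")
      (auto simp: partial_single Var_times_single lookup_single when_def)
qed (simp_all add: partial_plus lookup_add algebra_simps)

text \<open>
  Monomials are eigenvectors, with the weighted degree as eigenvalue.
\<close>

lemma lookup_torus: "Poly_Mapping.lookup (torus w p) m = wt w m * Poly_Mapping.lookup p m"
  by (simp add: torus_def lookup_sum lookup_Var_partial sum_distrib_right mult.assoc)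

lemma torus_derivation:
  fixes w :: "'n::finite \<Rightarrow> complex"
  shows "derivation (torus w)"
proof -
  have "derivation (\<lambda>p. pm_scale c (Var i * partial i p))" for c and i :: 'n
    using derivation_op_scale[OF derivation_mult_left[OF derivation_partial], of c "Var i" i]
    by (simp add: op_scale_def)
  then have "derivation (\<lambda>p. \<Sum>i\<in>I. pm_scale (w i) (Var i * partial i p))" for I
  proof (induction I rule: infinite_finite_induct)
    case (insert i I)
    then show ?case
      using derivation_plus[of "\<lambda>p. pm_scale (w i) (Var i * partial i p)" "\<lambda>p. \<Sum>i\<in>I. pm_scale (w i) (Var i * partial i p)"]
      by (simp add: plus_fun_def)
  qed (simp_all add: derivation_def)
  then show ?thesis by (simp add: torus_def)
qed

abbreviation euler :: "'n::finite \<Rightarrow> 'n mpoly \<Rightarrow> 'n mpoly" where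
  "euler i \<equiv> (\<lambda>p. Var i * partial i p)"

lemma euler_conv_torus: "euler i = torus (\<lambda>j. of_bool (j = i))"
  by (rule ext, rule poly_mapping_eqI) (simp add: lookup_torus lookup_Var_partial if_distrib cong: if_cong)

lemma torus_in_span: "torus w \<in> op.span (range euler)"
proof -
  have "(\<lambda>p. \<Sum>i\<in>I. pm_scale (w i) (Var i * partial i p)) \<in> op.span (range euler)" for I
  proof (induction I rule: infinite_finite_induct)
    case (insert i I)
    have "op_scale (w i) (euler i) + (\<lambda>p. \<Sum>i\<in>I. pm_scale (w i) (Var i * partial i p)) \<in> op.span (range euler)"
      by (intro op.span_add op.span_scale op.span_base insert.IH) blast
    moreover have "op_scale (w i) (euler i) + (\<lambda>p. \<Sum>i\<in>I. pm_scale (w i) (Var i * partial i p)) =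
        (\<lambda>p. \<Sum>i\<in>insert i I. pm_scale (w i) (Var i * partial i p))"
      using insert.hyps by (simp add: fun_eq_iff op_scale_def)
    ultimately show ?case by (simp only:)
  qed (use op.span_zero in \<open>simp_all add: zero_fun_def\<close>)
  then show ?thesis by (simp add: torus_def)
qed

lemma cartan_eq_range_torus: "(cartan :: ('n::{finite,linorder} mpoly \<Rightarrow> 'n mpoly) set) = range torus"
proof
  have "op.subspace (range torus :: ('n mpoly \<Rightarrow> 'n mpoly) set)"
  proof (rule op.subspaceI)
    show "(0 :: 'n mpoly \<Rightarrow> 'n mpoly) \<in> range torus"
      by (rule image_eqI[of _ _ "\<lambda>_. 0"]) (auto simp: torus_def fun_eq_iff)
    fix x :: "'n mpoly \<Rightarrow> 'n mpoly" assume "x \<in> range torus"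
    then obtain u where u: "x = torus u" by blast
    show "op_scale c x \<in> range torus" for c
      by (rule image_eqI[of _ _ "\<lambda>i. c * u i"])
        (auto simp: u fun_eq_iff op_scale_def lookup_torus sum_distrib_left algebra_simps intro!: poly_mapping_eqI)
    fix y :: "'n mpoly \<Rightarrow> 'n mpoly" assume "y \<in> range torus"
    then obtain v where v: "y = torus v" by blast
    show "x + y \<in> range torus"
      by (rule image_eqI[of _ _ "\<lambda>i. u i + v i"])
        (auto simp: u v fun_eq_iff lookup_torus lookup_add sum.distrib algebra_simps intro!: poly_mapping_eqI)
  qed
  moreover have "{euler i | i::'n. True} \<subseteq> range torus" using euler_conv_torus by blast
  ultimately show "cartan \<subseteq> (range torus :: ('n mpoly \<Rightarrow> 'n mpoly) set)"
    unfolding cartan_def by (intro op.span_minimal)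
  have "{euler i | i::'n. True} = range euler" by auto
  then show "range torus \<subseteq> (cartan :: ('n mpoly \<Rightarrow> 'n mpoly) set)"
    unfolding cartan_def using torus_in_span by auto
qed

lemma torus_commute: "commutator (torus u) (torus v) = 0"
  by (rule ext, rule poly_mapping_eqI) (simp add: commutator_apply lookup_minus lookup_torus)

lemma wt_single: "wt w (Poly_Mapping.single i n) = w i * of_nat n"
proof -
  have "wt w (Poly_Mapping.single i n) = (\<Sum>j\<in>UNIV. if i = j then w j * of_nat n else 0)"
    by (rule sum.cong) (auto simp: lookup_single when_def)
  then show ?thesis by simp
qed

lemma torus_single: "torus w (Poly_Mapping.single m c) = Poly_Mapping.single m (wt w m * c)"
  by (rule poly_mapping_eqI) (auto simp: lookup_torus lookup_single when_def)

lemma pm_scale_single: "pm_scale c (Poly_Mapping.single m e) = Poly_Mapping.single m (c * e)"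
  by (rule poly_mapping_eqI) (simp add: lookup_single when_def)

lemma torus_Var: "torus w (Var i) = pm_scale (w i) (Var i)"
  unfolding Var_def torus_single wt_single pm_scale_single by simp

lemma Var_power: "Var i ^ e = Poly_Mapping.single (Poly_Mapping.single i e) 1"
  by (induction e) (simp_all add: Var_times_single single_add[symmetric])

lemma torus_Var_power: "torus w (Var i ^ e) = pm_scale (of_nat e * w i) (Var i ^ e)"
  unfolding Var_power torus_single wt_single pm_scale_single by (simp add: mult.commute)

lemma partial_Var: "partial i (Var j) = (if i = j then 1 else 0)"
  by (auto simp: Var_def partial_single lookup_single when_def)

text \<open>
  Both sides are derivations, and they agree at the variables. For \<open>e = 0\<close> the generator is the
  partial derivative \<open>\<partial>\<^sub>k\<close>, so both kinds of generators are covered.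
\<close>

lemma commutator_torus_generator:
  fixes w :: "'n::finite \<Rightarrow> complex"
  shows "commutator (torus w) (\<lambda>p. Var j ^ e * partial k p) =
    op_scale (of_nat e * w j - w k) (\<lambda>p. Var j ^ e * partial k p)"
proof (rule derivation_eqI)
  have g: "derivation (\<lambda>p. Var j ^ e * partial k p)"
    by (intro derivation_mult_left derivation_partial)
  show "derivation (commutator (torus w) (\<lambda>p. Var j ^ e * partial k p))"
    by (intro derivation_commutator torus_derivation g)
  show "derivation (op_scale (of_nat e * w j - w k) (\<lambda>p. Var j ^ e * partial k p))"
    by (intro derivation_op_scale g)
  show "commutator (torus w) (\<lambda>p. Var j ^ e * partial k p) (Var l) =
    op_scale (of_nat e * w j - w k) (\<lambda>p. Var j ^ e * partial k p) (Var l)" for l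
    by (simp add: commutator_apply op_scale_def torus_Var partial_scale partial_Var torus_Var_power
        derivation_0[OF torus_derivation] pm.scale_left_diff_distrib)
      (simp add: pm_scale_conv_mult)
qed

lemma commutator_add_right:
  "derivation A \<Longrightarrow> commutator A (B + B') = commutator A B + commutator A B'"
  by (simp add: fun_eq_iff commutator_apply derivation_add)

lemma commutator_scale_right:
  "derivation A \<Longrightarrow> commutator A (op_scale c B) = op_scale c (commutator A B)"
  by (simp add: fun_eq_iff commutator_apply derivation_scale op_scale_def pm.scale_right_diff_distrib)

lemma commutator_skew: "commutator B A = - commutator A B"
  by (simp add: fun_eq_iff commutator_apply)

lemma commutator_jacobi:
  assumes "derivation A" "derivation B" "derivation C"
  shows "commutator A (commutator B C) = commutator (commutator A B) C + commutator B (commutator A C)"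
  by (simp add: fun_eq_iff commutator_apply derivation_diff assms)

section \<open>The grading of the Lie algebra of a tree diagram\<close>

lemma lie_subalgebra_L0: "lie_subalgebra (L0 E d)"
  unfolding L0_def
proof (rule hull_in)
  fix T :: "('a mpoly \<Rightarrow> 'a mpoly) set set" assume "Ball T lie_subalgebra"
  then show "lie_subalgebra (\<Inter>T)" unfolding lie_subalgebra_def by (auto intro: op.subspace_Inter)
qed

lemma L0_subset: "L0_generators E d \<subseteq> S \<Longrightarrow> lie_subalgebra S \<Longrightarrow> L0 E d \<subseteq> S"
  unfolding L0_def by (rule hull_minimal)

lemma generators_in_L0: "L0_generators E d \<subseteq> L0 E d"
  unfolding L0_def by (rule hull_subset)

lemma L0_subspace: "op.subspace (L0 E d)"
  and L0_commutator: "A \<in> L0 E d \<Longrightarrow> B \<in> L0 E d \<Longrightarrow> commutator A B \<in> L0 E d"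
  using lie_subalgebra_L0[of E d] by (auto simp: lie_subalgebra_def)

lemma lie_subalgebra_derivations: "lie_subalgebra (Collect derivation)"
  unfolding lie_subalgebra_def
  by (auto intro!: op.subspaceI derivation_zero derivation_plus derivation_op_scale derivation_commutator)

text \<open>
  A root generator is written with exponent zero, where the node of the variable is arbitrary and
  is taken to be the root itself; so \<open>commutator_torus_generator\<close> applies to both cases.
\<close>

lemma generatorE:
  assumes "A \<in> L0_generators E d"
  obtains i where "i \<in> root_nodes E" "A = (\<lambda>p. Var i ^ 0 * partial i p)"
  | j k where "(j, k) \<in> E" "A = (\<lambda>p. Var j ^ d (j, k) * partial k p)"
  using assms by (auto simp: L0_generators_def)

lemma L0_derivation: "A \<in> L0 E d \<Longrightarrow> derivation A"
proof -
  have "L0_generators E d \<subseteq> Collect derivation"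
    by (auto simp: L0_generators_def intro: derivation_partial derivation_mult_left)
  from L0_subset[OF this lie_subalgebra_derivations] show "A \<in> L0 E d \<Longrightarrow> derivation A" by blast
qed

text \<open>
  The elements of \<open>L0\<close> that are mapped to \<open>L0\<close> by bracketing with a diagonal field form a Lie
  subalgebra, by the Jacobi identity, and contain the generators, which are eigenvectors.
\<close>

lemma torus_normalizes_L0:
  assumes "A \<in> L0 E d"
  shows "commutator (torus w) A \<in> L0 E d"
proof -
  let ?S = "{A \<in> L0 E d. commutator (torus w) A \<in> L0 E d}"
  have "lie_subalgebra ?S"
    unfolding lie_subalgebra_def
  proof (intro conjI ballI op.subspaceI)
    have "commutator (torus w) 0 = 0" by (simp add: fun_eq_iff commutator_apply derivation_0[OF torus_derivation])
    then show "0 \<in> ?S" using op.subspace_0[OF L0_subspace] by simp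
  next
    fix A B assume "A \<in> ?S" "B \<in> ?S"
    then show "A + B \<in> ?S"
      unfolding mem_Collect_eq commutator_add_right[OF torus_derivation]
      by (blast intro: op.subspace_add[OF L0_subspace])
  next
    fix c A assume "A \<in> ?S"
    then show "op_scale c A \<in> ?S"
      unfolding mem_Collect_eq commutator_scale_right[OF torus_derivation]
      by (blast intro: op.subspace_scale[OF L0_subspace])
  next
    fix A B assume "A \<in> ?S" "B \<in> ?S"
    then show "commutator A B \<in> ?S"
      using commutator_jacobi[OF torus_derivation L0_derivation L0_derivation, of A E d B E d w]
      by (auto intro!: op.subspace_add[OF L0_subspace] L0_commutator)
  qed
  moreover have "L0_generators E d \<subseteq> ?S"
  proof
    fix A assume A: "A \<in> L0_generators E d"
    then have "\<exists>c. commutator (torus w) A = op_scale c A"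
      by (cases rule: generatorE) (metis commutator_torus_generator)+
    then show "A \<in> ?S" using A generators_in_L0 op.subspace_scale[OF L0_subspace] by fastforce
  qed
  ultimately show ?thesis using L0_subset assms by blast
qed

text \<open>
  The condition says that with respect to the weights \<open>w\<close> every generator of \<open>L0\<close> has negative
  weighted degree.
\<close>

definition growing_weight :: "('n \<times> 'n) set \<Rightarrow> ('n \<times> 'n \<Rightarrow> nat) \<Rightarrow> ('n \<Rightarrow> nat) \<Rightarrow> bool" where
  "growing_weight E d w \<longleftrightarrow> (\<forall>k. 0 < w k) \<and> (\<forall>(j, k) \<in> E. d (j, k) * w j < w k)"

text \<open>
  Powers of a number \<open>D\<close> larger than all values of \<open>d\<close> work, the exponent being the position of
  the node in the linear order: an edge increases the position, hence multiplies the weight by at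
  least \<open>D\<close>.
\<close>

lemma growing_weight_exists:
  fixes E :: "('n::{finite,linorder} \<times> 'n) set"
  assumes "\<forall>(i, j) \<in> E. i < j"
  obtains w where "growing_weight E d w"
proof -
  define D where "D = Suc (\<Sum>e\<in>UNIV. d e)"
  define w where "w k = D ^ Suc (card {j. j < k})" for k :: 'n
  have "d (j, k) * w j < w k" if "(j, k) \<in> E" for j k
  proof -
    have "j < k" using that assms by blast
    then have "{l. l < j} \<subset> {l. l < k}" by fastforce
    then have "Suc (card {l. l < j}) \<le> card {l. l < k}" by (simp add: Suc_leI psubset_card_mono)
    then have "D ^ Suc (Suc (card {l. l < j})) \<le> w k" unfolding w_def by (intro power_increasing) (auto simp: D_def)
    moreover have "d (j, k) < D" unfolding D_def by (simp add: less_Suc_eq_le member_le_sum)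
    ultimately show ?thesis
      by (metis D_def less_le_trans mult_less_mono1 power_Suc w_def zero_less_Suc zero_less_power)
  qed
  then have "growing_weight E d w" by (auto simp: growing_weight_def w_def D_def)
  then show thesis by (rule that)
qed

abbreviation grading :: "('n::finite \<Rightarrow> nat) \<Rightarrow> 'n mpoly \<Rightarrow> 'n mpoly" where
  "grading w \<equiv> torus (\<lambda>i. of_nat (w i))"

text \<open>
  The part of \<open>L0\<close> of degree \<open>m\<close>: its elements lower weighted degrees by \<open>m\<close>.
\<close>

definition L0_part :: "('n::{finite,linorder} \<times> 'n) set \<Rightarrow> ('n \<times> 'n \<Rightarrow> nat) \<Rightarrow> ('n \<Rightarrow> nat) \<Rightarrow> nat
    \<Rightarrow> ('n mpoly \<Rightarrow> 'n mpoly) set" where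
  "L0_part E d w m = {A \<in> L0 E d. commutator (grading w) A = op_scale (- of_nat m) A}"

lemma L0_part_commutator:
  assumes A: "A \<in> L0_part E d w m" and B: "B \<in> L0_part E d w n"
  shows "commutator A B \<in> L0_part E d w (m + n)"
proof -
  have L: "A \<in> L0 E d" "B \<in> L0 E d" using A B by (auto simp: L0_part_def)
  note dA = L0_derivation[OF L(1)] and dB = L0_derivation[OF L(2)]
  have "commutator (grading w) (commutator A B) =
      commutator (op_scale (- of_nat m) A) B + commutator A (op_scale (- of_nat n) B)"
    using commutator_jacobi[OF torus_derivation dA dB] A B by (simp add: L0_part_def)
  also have "\<dots> = op_scale (- of_nat (m + n)) (commutator A B)"
    unfolding fun_eq_iff plus_fun_apply commutator_apply op_scale_def derivation_scale[OF dA]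
      derivation_scale[OF dB]
    by (simp add: pm.scale_right_diff_distrib pm.scale_left_distrib algebra_simps)
  finally show ?thesis using L0_commutator[OF L] by (simp add: L0_part_def)
qed

text \<open>
  An element of degree \<open>m\<close> maps \<open>x\<^sub>k\<close>, of weight \<open>w k\<close>, to a polynomial which is homogeneous of
  weighted degree \<open>w k - m\<close>. The equation says that the coefficient of a monomial of another degree
  is zero.
\<close>

lemma L0_part_coefficient:
  assumes A: "A \<in> L0_part E d w m"
  shows "(wt (\<lambda>i. of_nat (w i)) n + of_nat m) * Poly_Mapping.lookup (A (Var k)) n =
    of_nat (w k) * Poly_Mapping.lookup (A (Var k)) n"
proof -
  have dA: "derivation A" using A L0_derivation by (auto simp: L0_part_def)
  have "commutator (grading w) A (Var k) = op_scale (- of_nat m) A (Var k)"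
    using A by (simp add: L0_part_def)
  then have "grading w (A (Var k)) = pm_scale (of_nat (w k)) (A (Var k)) - pm_scale (of_nat m) (A (Var k))"
    by (simp add: commutator_apply op_scale_def torus_Var derivation_scale[OF dA] algebra_simps)
  then have "Poly_Mapping.lookup (grading w (A (Var k))) n =
      (of_nat (w k) - of_nat m) * Poly_Mapping.lookup (A (Var k)) n"
    by (simp only: lookup_minus lookup_pm_scale left_diff_distrib)
  then show ?thesis by (simp add: lookup_torus algebra_simps)
qed

text \<open>
  Weighted degrees of monomials are not negative, so all values at variables are zero.
\<close>

lemma L0_part_large:
  assumes A: "A \<in> L0_part E d w m" and m: "\<And>k. w k < m"
  shows "A = 0"
proof (rule derivation_eqI)
  show "derivation A" using A L0_derivation by (auto simp: L0_part_def)
  show "derivation 0" by (rule derivation_zero)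
  fix k
  have "Poly_Mapping.lookup (A (Var k)) n = 0" for n
  proof (rule ccontr)
    assume "Poly_Mapping.lookup (A (Var k)) n \<noteq> 0"
    with L0_part_coefficient[OF A, of n k]
    have "complex_of_nat ((\<Sum>i\<in>UNIV. w i * Poly_Mapping.lookup n i) + m) = of_nat (w k)" by simp
    then have "(\<Sum>i\<in>UNIV. w i * Poly_Mapping.lookup n i) + m = w k" by (simp only: of_nat_eq_iff)
    then show False using m[of k] by simp
  qed
  then show "A (Var k) = 0 (Var k)" by (intro poly_mapping_eqI) simp
qed

text \<open>
  The value at \<open>x\<^sub>i\<close> has smaller weighted degree than \<open>x\<^sub>i\<close> and so does not contain this monomial.
\<close>

lemma L0_part_diagonal:
  assumes A: "A \<in> L0_part E d w m" and m: "0 < m"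
  shows "Poly_Mapping.lookup (A (Var i)) (Poly_Mapping.single i 1) = 0"
  using L0_part_coefficient[OF A, of "Poly_Mapping.single i 1" i] m by (simp only: wt_single) (simp add: algebra_simps)

text \<open>
  The span of the parts of positive degree is a Lie subalgebra, because degrees add under
  brackets, and it contains the generators.
\<close>

lemma L0_subset_span_parts:
  fixes E :: "('n::{finite,linorder} \<times> 'n) set"
  assumes w: "growing_weight E d w"
  shows "L0 E d \<subseteq> op.span (\<Union>m\<in>{1..}. L0_part E d w m)"
proof (rule L0_subset)
  let ?P = "\<Union>m\<in>{1..}. L0_part E d w m"
  show "L0_generators E d \<subseteq> op.span ?P"
  proof
    fix A assume A: "A \<in> L0_generators E d"
    then have "\<exists>m\<ge>1. commutator (grading w) A = op_scale (- of_nat m) A"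
    proof (cases rule: generatorE)
      case (1 i)
      then show ?thesis using w unfolding 1(2) commutator_torus_generator
        by (intro exI[of _ "w i"]) (simp add: growing_weight_def Suc_leI)
    next
      case (2 j k)
      then have "d (j, k) * w j < w k" using w by (auto simp: growing_weight_def)
      then show ?thesis unfolding 2(2) commutator_torus_generator
        by (intro exI[of _ "w k - d (j, k) * w j"]) (simp add: of_nat_diff)
    qed
    then have "A \<in> ?P" using A generators_in_L0 unfolding L0_part_def by fastforce
    then show "A \<in> op.span ?P" by (rule op.span_base)
  qed
  have P: "derivation A" if "A \<in> ?P" for A using that L0_derivation by (auto simp: L0_part_def)
  have spP: "derivation A" if "A \<in> op.span ?P" for A
  proof -
    have "op.span ?P \<subseteq> Collect derivation"
      by (rule op.span_minimal) (use P lie_subalgebra_derivations in \<open>auto simp: lie_subalgebra_def\<close>)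
    then show ?thesis using that by blast
  qed
  have one: "commutator A B \<in> op.span ?P" if A: "A \<in> ?P" and B: "B \<in> op.span ?P" for A B
    using B
  proof (induction rule: op.span_induct_alt)
    case base
    have "commutator A 0 = 0" using P[OF A] by (simp add: fun_eq_iff commutator_apply derivation_0)
    then show ?case by (simp only: op.span_zero)
  next
    case (step c B C)
    obtain m n where mn: "1 \<le> m" "A \<in> L0_part E d w m" "B \<in> L0_part E d w n"
      using A step(1) by auto
    have "commutator A B \<in> ?P"
      by (rule UN_I[of "m + n"]) (use mn L0_part_commutator in auto)
    then show ?case
      unfolding commutator_add_right[OF P[OF A]] commutator_scale_right[OF P[OF A]]
      by (intro op.span_add op.span_scale step(2)) (rule op.span_base)
  qed
  have "commutator A B \<in> op.span ?P" if A: "A \<in> op.span ?P" and B: "B \<in> op.span ?P" for A B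
  proof -
    have "commutator B A \<in> op.span ?P"
      using A
    proof (induction rule: op.span_induct_alt)
      case base
      have "commutator B 0 = 0" using spP[OF B] by (simp add: fun_eq_iff commutator_apply derivation_0)
      then show ?case by (simp only: op.span_zero)
    next
      case (step c A C)
      have "commutator B A \<in> op.span ?P"
        using op.span_neg[OF one[OF step(1) B]] commutator_skew[of B A] by simp
      then show ?case
        unfolding commutator_add_right[OF spP[OF B]] commutator_scale_right[OF spP[OF B]]
        by (intro op.span_add op.span_scale step(2))
    qed
    then show ?thesis using op.span_neg[of "commutator B A"] commutator_skew[of A B] by simp
  qed
  then show "lie_subalgebra (op.span ?P)" by (simp add: lie_subalgebra_def)
qed

lemma L0_subset_span_bounded_parts:
  fixes E :: "('n::{finite,linorder} \<times> 'n) set"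
  assumes w: "growing_weight E d w"
  shows "L0 E d \<subseteq> op.span (\<Union>m\<in>{1..Max (range w)}. L0_part E d w m)" (is "_ \<subseteq> op.span ?Q")
proof -
  have "(\<Union>m\<in>{1..}. L0_part E d w m) \<subseteq> op.span ?Q"
  proof
    fix A assume "A \<in> (\<Union>m\<in>{1..}. L0_part E d w m)"
    then obtain m where m: "1 \<le> m" "A \<in> L0_part E d w m" by auto
    show "A \<in> op.span ?Q"
    proof (cases "m \<le> Max (range w)")
      case True
      then show ?thesis using m by (intro op.span_base) auto
    next
      case False
      have "w k \<le> Max (range w)" for k by (rule Max_ge) simp_all
      then have "w k < m" for k using False le_less_trans not_le by blast
      then show ?thesis using L0_part_large[OF m(2)] op.span_zero by simp
    qed
  qed
  then show ?thesis
    using L0_subset_span_parts[OF w] op.span_minimal[OF _ op.subspace_span] by (meson subset_trans)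
qed

text \<open>
  The coefficient of \<open>x\<^sub>i \<partial>\<^sub>i\<close> in a vector field. These coefficients are dual to the basis of the
  Cartan part, and they vanish on \<open>L0\<close> for reasons of degree.
\<close>

definition diag_coeff :: "'n \<Rightarrow> ('n mpoly \<Rightarrow> 'n mpoly) \<Rightarrow> complex" where
  "diag_coeff i A = Poly_Mapping.lookup (A (Var i)) (Poly_Mapping.single i 1)"

lemma diag_coeff_linear: "diag_coeff i (op_scale c A + B) = c * diag_coeff i A + diag_coeff i B"
  by (simp add: diag_coeff_def op_scale_def lookup_add)

lemma diag_coeff_euler: "diag_coeff i (euler j) = of_bool (i = j)"
  unfolding diag_coeff_def lookup_Var_partial by (auto simp: Var_def lookup_single when_def)

lemma diag_coeff_L0:
  fixes E :: "('n::{finite,linorder} \<times> 'n) set"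
  assumes w: "growing_weight E d w" and A: "A \<in> L0 E d"
  shows "diag_coeff i A = 0"
proof -
  have "A \<in> op.span (\<Union>m\<in>{1..}. L0_part E d w m)" using L0_subset_span_parts[OF w] A by blast
  then show ?thesis
  proof (induction rule: op.span_induct_alt)
    case (step c A B)
    then have "diag_coeff i A = 0" using L0_part_diagonal[of A E d w _ i] by (auto simp: diag_coeff_def)
    then show ?case using step(2) by (simp only: diag_coeff_linear) simp
  qed (simp add: diag_coeff_def)
qed

lemma L1_iff: "A \<in> L1 E d \<longleftrightarrow> (\<exists>u. \<exists>B\<in>L0 E d. A = torus u + B)"
  by (auto simp: L1_def cartan_eq_range_torus set_plus_def)

lemma L0_subset_L1: "L0 E d \<subseteq> L1 E d"
proof
  fix A assume "A \<in> L0 E d"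
  moreover have "torus (\<lambda>_. 0) = (0 :: 'a mpoly \<Rightarrow> 'a mpoly)" by (simp add: torus_def fun_eq_iff)
  ultimately show "A \<in> L1 E d" unfolding L1_iff by (metis add_0)
qed

lemma cartan_subset_L1: "cartan \<subseteq> L1 E d"
  using op.subspace_0[OF L0_subspace] unfolding L1_def set_plus_def by force

lemma L1_subspace: "op.subspace (L1 E d)"
proof -
  have "op.subspace (cartan :: ('a mpoly \<Rightarrow> 'a mpoly) set)" by (simp add: cartan_def)
  from op.subspace_sums[OF this L0_subspace] show ?thesis
    by (simp add: L1_def set_plus_def Bex_def conj_ac)
qed

lemma L1_derivation: "A \<in> L1 E d \<Longrightarrow> derivation A"
  by (auto simp: L1_iff intro: derivation_plus torus_derivation L0_derivation)

text \<open>
  The Cartan part is abelian and normalizes \<open>L0\<close>; so all brackets fall into \<open>L0\<close>.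
\<close>

lemma L1_commutator:
  assumes "A \<in> L1 E d" "B \<in> L1 E d"
  shows "commutator A B \<in> L0 E d"
proof -
  obtain u v X Y where X: "X \<in> L0 E d" and Y: "Y \<in> L0 E d"
    and A: "A = torus u + X" and B: "B = torus v + Y" using assms by (auto simp: L1_iff)
  have "commutator A B = commutator (torus u) Y - commutator (torus v) X + commutator X Y + commutator (torus u) (torus v)"
    by (simp add: A B fun_eq_iff commutator_apply derivation_add[OF torus_derivation]
        derivation_add[OF L0_derivation[OF X]] derivation_add[OF L0_derivation[OF Y]])
  then show ?thesis
    using torus_normalizes_L0[OF X] torus_normalizes_L0[OF Y] L0_commutator[OF X Y]
    by (simp add: torus_commute op.subspace_add[OF L0_subspace] op.subspace_diff[OF L0_subspace])
qed

section \<open>Cohomology of the Lie algebra of a tree diagram\<close>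

text \<open>
  The grading element of a growing weight puts the algebra into the situation of
  \<open>cohomology_iso_ext_power\<close>, with the Cartan part in degree zero and \<open>L0\<close> in the degrees from
  \<open>1\<close> to the largest weight.
\<close>

theorem theorem5p2:
  fixes E :: "('n::{finite,linorder} \<times> 'n) set" and d :: "'n \<times> 'n \<Rightarrow> nat"
  assumes "oriented_tree_diagram E d"
  shows "graded_iso (ce_cohomology op_scale commutator (L1 E d))
           (ext_power op_scale (cartan :: ('n mpoly \<Rightarrow> 'n mpoly) set))"
proof -
  have "\<forall>(i, j) \<in> E. i < j" using assms by (simp add: oriented_tree_diagram_def oriented_tree_def)
  then obtain w where w: "growing_weight E d w" by (rule growing_weight_exists)
  \<comment> \<open>set to zero outside the algebra, as linear forms on it are encoded\<close>
  define lam where "lam i A = (if A \<in> L1 E d then diag_coeff i A else 0)" for i A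
  define B where "B m = (if m = 0 then range euler else L0_part E d w m)" for m
  have cartan: "(cartan :: ('n mpoly \<Rightarrow> 'n mpoly) set) = op.span (range euler)"
    unfolding cartan_def by (rule arg_cong[of _ _ op.span]) auto
  have euler: "euler i \<in> cartan" for i :: 'n unfolding cartan by (intro op.span_base) blast
  interpret form_space op_scale "L1 E d" by unfold_locales (rule L1_subspace)
  interpret lie_coframe op_scale "L1 E d" commutator euler lam
  proof unfold_locales
    fix x y z c assume xyz: "x \<in> L1 E d" "y \<in> L1 E d"
    show "commutator x y \<in> L1 E d" using L1_commutator[OF xyz] L0_subset_L1 by blast
    show "commutator y x = - commutator x y" by (rule commutator_skew)
    show "commutator x x = 0" by (simp add: commutator_def)
    show "commutator x (op_scale c y + z) = op_scale c (commutator x y) + commutator x z"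
      using L1_derivation[OF xyz(1)] by (simp add: commutator_add_right commutator_scale_right)
    show "lam i (commutator x y) = 0" for i
      using diag_coeff_L0[OF w L1_commutator[OF xyz]] by (simp add: lam_def)
    assume z: "z \<in> L1 E d"
    show "commutator x (commutator y z) = commutator (commutator x y) z + commutator y (commutator x z)"
      by (intro commutator_jacobi L1_derivation[of _ E d] xyz z)
  next
    show "euler i \<in> L1 E d" for i using euler cartan_subset_L1 by blast
    then show "lam i (euler j) = of_bool (i = j)" for i j by (simp add: lam_def diag_coeff_euler)
    show "functional (lam i)" for i
      using L_add L_scale by (simp add: functional_def lam_def diag_coeff_linear)
    show "commutator (euler i) (euler j) = 0" for i j unfolding euler_conv_torus by (rule torus_commute)
  qed
  show ?thesis
  proof (rule cohomology_iso_ext_power)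
    have "grading w \<in> cartan" by (simp add: cartan_eq_range_torus)
    then show h: "grading w \<in> L1 E d" using cartan_subset_L1 by blast
    show "B m \<subseteq> weight_space (grading w) m" for m
    proof (cases "m = 0")
      case True
      have "commutator (grading w) (euler i) = 0" for i unfolding euler_conv_torus by (rule torus_commute)
      then show ?thesis using True b_in by (auto simp: B_def weight_space_def)
    next
      case False
      then show ?thesis using L0_subset_L1 by (auto simp: B_def weight_space_def L0_part_def)
    qed
    let ?U = "\<Union>m\<le>Max (range w). B m"
    have "L0 E d \<subseteq> op.span ?U"
    proof -
      have "(\<Union>m\<in>{1..Max (range w)}. L0_part E d w m) \<subseteq> ?U" by (force simp: B_def)
      then show ?thesis using L0_subset_span_bounded_parts[OF w] op.span_mono by blast
    qed
    moreover have "cartan \<subseteq> op.span ?U"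
      unfolding cartan by (rule op.span_mono) (force simp: B_def)
    ultimately show "L1 E d \<subseteq> op.span ?U"
      unfolding L1_def by (auto elim!: set_plus_elim intro: op.span_add)
    show "B 0 = range euler" by (simp add: B_def)
    show "op.subspace (cartan :: ('n mpoly \<Rightarrow> 'n mpoly) set)" unfolding cartan by (rule op.subspace_span)
    show "range euler \<subseteq> (cartan :: ('n mpoly \<Rightarrow> 'n mpoly) set)" using euler by blast
    show "cartan \<subseteq> L1 E d" by (rule cartan_subset_L1)
    show "(cartan :: ('n mpoly \<Rightarrow> 'n mpoly) set) \<subseteq> op.span (range euler)" by (simp add: cartan)
  qed
qed

end
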